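(* Let $p$ be a prime and $\lambda$ a fixed integer partition. Then, as formal power series in $z$, $$\sum_{\mu}\frac{x^\lambda(H_\mu)}{|\mathrm{Aut}(H_\mu)|}z^{|\mu|}=\frac{1}{(z/p;1/p)_\infty}\sum_{\nu\subseteq\lambda}C_{\lambda,\nu}(p)\,z^{|\nu|},$$ where the left sum is over all integer partitions $\mu$ and the right sum over all partitions $\nu$ with $\nu_i\le\lambda_i$ for all $i$.
   Context: For a partition $\mu=1^{n_1}2^{n_2}\cdots$ ($n_i$ parts equal to $i$), $H_\mu=\bigoplus_i(\mathbb Z/p^i\mathbb Z)^{n_i}$. For $\lambda=1^{m_1}\cdots\ell^{m_\ell}$ and a finite abelian $p$-group $H$, $x^\lambda(H)=|H[p]|^{m_1}|H[p^2]|^{m_2}\cdots|H[p^\ell]|^{m_\ell}$, where $H[p^k]$ is the $p^k$-torsion subgroup. $\lambda'$ denotes the conjugate partition, $(a;q)_\infty=\prod_{j\ge0}(1-aq^j)$, $(q)_k=(1-q)\cdots(1-q^k)$, $\begin{bmatrix}n\\k\end{bmatrix}_q=\frac{(q)_n}{(q)_k(q)_{n-k}}$, and $C_{\lambda,\nu}(q)=q^{\sum_{i\ge1}\nu'_{i+1}(\lambda'_i-\nu'_i)}\prod_{i\ge1}\begin{bmatrix}\lambda'_i-\nu'_{i+1}\\ \lambda'_i-\nu'_i\end{bmatrix}_q$. *)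

theory Defs
  imports
    "HOL-Analysis.Analysis"
    "HOL-Algebra.Bij"
    "HOL-Algebra.Product_Groups"
    "HOL-Computational_Algebra.Formal_Power_Series"
    "HOL-Computational_Algebra.Primes"
    "HOL-Library.Multiset"
begin

text \<open>An integer partition is the multiset of its (positive) parts, so that
  \<open>count lam i\<close> is the multiplicity of \<open>i\<close> and \<open>sum_mset lam\<close> is \<open>|lam|\<close>.\<close>

definition int_partition :: "nat multiset \<Rightarrow> bool" where
  "int_partition lam \<longleftrightarrow> 0 \<notin># lam"

text \<open>Indices start at 0: \<open>nth_part lam 0\<close> is the largest part, and parts beyond the length are 0.\<close>

definition nth_part :: "nat multiset \<Rightarrow> nat \<Rightarrow> nat" where
  "nth_part lam i = (if i < size lam then rev (sorted_list_of_multiset lam) ! i else 0)"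

definition part_le :: "nat multiset \<Rightarrow> nat multiset \<Rightarrow> bool" where
  "part_le nu lam \<longleftrightarrow> (\<forall>i. nth_part nu i \<le> nth_part lam i)"

text \<open>The \<open>i\<close>-th part of the conjugate partition, for \<open>i \<ge> 1\<close>.\<close>

definition conj_part :: "nat multiset \<Rightarrow> nat \<Rightarrow> nat" where
  "conj_part lam i = size {#j \<in># lam. i \<le> j#}"

text \<open>The direct sum is indexed by the pairs \<open>(i, j)\<close> with \<open>j < count mu i\<close>; the component at
  \<open>(i, j)\<close> is the \<open>j\<close>-th copy of the cyclic group of order \<open>p ^ i\<close>.\<close>

definition pgroup :: "nat \<Rightarrow> nat multiset \<Rightarrow> (nat \<times> nat \<Rightarrow> int) monoid" where
  "pgroup p mu =
     sum_group (SIGMA i:set_mset mu. {..<count mu i}) (\<lambda>(i, j). integer_mod_group (p ^ i))"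

definition torsion :: "('a, 'b) monoid_scheme \<Rightarrow> nat \<Rightarrow> 'a set" where
  "torsion G n = {x \<in> carrier G. x [^]\<^bsub>G\<^esub> n = \<one>\<^bsub>G\<^esub>}"

definition torsion_monomial :: "nat \<Rightarrow> nat multiset \<Rightarrow> ('a, 'b) monoid_scheme \<Rightarrow> nat" where
  "torsion_monomial p lam G = (\<Prod>i\<in>set_mset lam. card (torsion G (p ^ i)) ^ count lam i)"

definition qpoch :: "real \<Rightarrow> nat \<Rightarrow> real" where
  "qpoch q k = (\<Prod>j=1..k. 1 - q ^ j)"

definition qbinom :: "real \<Rightarrow> nat \<Rightarrow> nat \<Rightarrow> real" where
  "qbinom q n k = qpoch q n / (qpoch q k * qpoch q (n - k))"

text \<open>This is only used for \<open>part_le nu lam\<close>, in which case the subtractions do not truncate.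
  The sum and the product over all \<open>i \<ge> 1\<close> are cut off at the largest part of \<open>lam\<close>:
  beyond it the conjugate parts of \<open>lam\<close> and \<open>nu\<close> vanish.\<close>

definition Ccoeff :: "nat multiset \<Rightarrow> nat multiset \<Rightarrow> real \<Rightarrow> real" where
  "Ccoeff lam nu q =
     q ^ (\<Sum>i=1..nth_part lam 0. conj_part nu (i + 1) * (conj_part lam i - conj_part nu i)) *
     (\<Prod>i=1..nth_part lam 0.
        qbinom q (conj_part lam i - conj_part nu (i + 1)) (conj_part lam i - conj_part nu i))"

text \<open>The infinite product \<open>(a; q)\<^sub>\<infinity>\<close> for a formal power series \<open>a\<close> and a real number \<open>q\<close>.
  For \<open>a \<noteq> 0\<close> with zero constant term and \<open>0 < \<bar>q\<bar> < 1\<close> it does not converge in the metric of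
  \<^typ>\<open>real fps\<close> (in which every coefficient is eventually constant along a convergent sequence),
  so the limit of the partial products is taken coefficientwise in the real numbers.\<close>

definition qpoch_inf :: "real fps \<Rightarrow> real \<Rightarrow> real fps" where
  "qpoch_inf a q = Abs_fps (\<lambda>n. lim (\<lambda>N. fps_nth (\<Prod>j<N. 1 - a * fps_const (q ^ j)) n))"

lemma qpoch_inf_tendsto:
  fixes a :: "real fps" and q :: real
  assumes a: "fps_nth a 0 = 0" and q: "\<bar>q\<bar> < 1"
  shows "(\<lambda>N. fps_nth (\<Prod>j<N. 1 - a * fps_const (q ^ j)) n) \<longlonglongrightarrow> fps_nth (qpoch_inf a q) n"
proof -
  define P where "P N = (\<Prod>j<N. 1 - a * fps_const (q ^ j))" for N
  have step: "fps_nth (P (Suc N)) n - fps_nth (P N) n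
      = - (q ^ N * (\<Sum>i=0..n. fps_nth a i * fps_nth (P N) (n - i)))" for N n
  proof -
    have "P (Suc N) - P N = - (fps_const (q ^ N) * (a * P N))"
      by (simp add: P_def algebra_simps)
    then have "fps_nth (P (Suc N) - P N) n = - (q ^ N * fps_nth (a * P N) n)"
      by simp
    then show ?thesis by (simp add: fps_mult_nth)
  qed
  have "convergent (\<lambda>N. fps_nth (P N) n)" for n
  proof (induction n rule: less_induct)
    case (less n)
    define S where "S N = (\<Sum>i=0..n. fps_nth a i * fps_nth (P N) (n - i))" for N
    have "convergent S"
    proof -
      have "convergent (\<lambda>N. fps_nth a i * fps_nth (P N) (n - i))" if "i \<in> {0..n}" for i
      proof (cases "i = 0")
        case True
        then show ?thesis using a by (simp add: convergent_const)
      next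
        case False
        then show ?thesis using less.IH[of "n - i"] that
          by (intro convergent_mult convergent_const) auto
      qed
      then show ?thesis unfolding S_def[abs_def] by (intro convergent_sum)
    qed
    then have "Bseq S" by (rule convergent_imp_Bseq)
    then obtain B where B: "\<And>N. norm (S N) \<le> B" by (auto simp: Bseq_def)
    have "summable (\<lambda>N. fps_nth (P (Suc N)) n - fps_nth (P N) n)"
    proof (rule summable_comparison_test')
      show "summable (\<lambda>N. B * \<bar>q\<bar> ^ N)"
        using q by (intro summable_mult summable_geometric) simp
      show "norm (fps_nth (P (Suc N)) n - fps_nth (P N) n) \<le> B * \<bar>q\<bar> ^ N" if "N \<ge> 0" for N
        using mult_right_mono[OF B[of N], of "\<bar>q\<bar> ^ N"]
        unfolding step S_def[symmetric] by (simp add: abs_mult power_abs mult.commute)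
    qed
    then have "convergent (\<lambda>N. \<Sum>k<N. fps_nth (P (Suc k)) n - fps_nth (P k) n)"
      by (simp add: summable_iff_convergent)
    then have "convergent (\<lambda>N. fps_nth (P N) n - fps_nth (P 0) n)"
      by (subst (asm) sum_lessThan_telescope)
    then show ?case by (simp add: convergent_diff_const_right_iff)
  qed
  then show ?thesis
    by (simp add: P_def[symmetric] qpoch_inf_def convergent_LIMSEQ_iff)
qed

lemma finite_part_le: "finite {nu. int_partition nu \<and> part_le nu lam}"
proof (rule finite_subset)
  show "finite (\<Union>n\<le>size lam. {nu. set_mset nu \<subseteq> {..nth_part lam 0} \<and> size nu = n})"
    using finite_multisets_of_size[of "{..nth_part lam 0}"] by (auto simp: multisets_of_size_def)
  show "{nu. int_partition nu \<and> part_le nu lam}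
      \<subseteq> (\<Union>n\<le>size lam. {nu. set_mset nu \<subseteq> {..nth_part lam 0} \<and> size nu = n})"
  proof safe
    fix nu assume nu: "int_partition nu" "part_le nu lam"
    define xs where "xs = rev (sorted_list_of_multiset nu)"
    have xs: "set xs = set_mset nu" "length xs = size nu" "sorted (rev xs)"
      by (simp_all add: xs_def) (metis mset_sorted_list_of_multiset size_mset)
    have px: "nth_part nu i = xs ! i" if "i < length xs" for i
      using that xs by (simp add: nth_part_def xs_def)
    have *: "size nu \<le> size lam"
    proof (rule ccontr)
      assume h: "\<not> size nu \<le> size lam"
      then have "xs ! size lam \<in># nu" using xs by (metis nth_mem not_le)
      then have "xs ! size lam \<noteq> 0" using nu(1) by (metis int_partition_def)
      moreover have "nth_part nu (size lam) \<le> nth_part lam (size lam)" using nu(2) by (simp add: part_le_def)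
      moreover have "nth_part lam (size lam) = 0" by (simp add: nth_part_def)
      ultimately show False using px[of "size lam"] h xs by simp
    qed
    have "y \<le> nth_part lam 0" if y: "y \<in># nu" for y
    proof -
      obtain i where i: "i < length xs" "y = xs ! i" using y xs by (metis in_set_conv_nth)
      have "xs ! i \<le> xs ! 0" using i xs(3) by (intro sorted_rev_nth_mono) auto
      also have "xs ! 0 = nth_part nu 0" using i by (intro px[symmetric]) linarith
      also have "\<dots> \<le> nth_part lam 0" using nu(2) by (simp add: part_le_def)
      finally show ?thesis using i by simp
    qed
    then show "nu \<in> (\<Union>n\<le>size lam. {nu. set_mset nu \<subseteq> {..nth_part lam 0} \<and> size nu = n})"
      using * by auto
  qed
qed

end

theory Submission
  imports Defs
begin

text \<open>
  Put \<open>t = 1/p\<close>. Deleting the first column of the Young diagram of \<open>mu\<close>, of length \<open>r\<close>, leaves a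
  partition \<open>nu\<close> with \<open>|Aut H_mu| = p^(r^2) (t)_(r-s) |Aut H_nu|\<close>, where \<open>s\<close> is the length of the
  first column of \<open>nu\<close>. Deleting the first columns of \<open>lam\<close> and \<open>mu\<close> divides the torsion monomial by
  \<open>p^(r l)\<close>, where \<open>l\<close> is the length of the first column of \<open>lam\<close>. The formula for \<open>|Aut H_mu|\<close> comes
  from building an embedding of \<open>H_mu\<close> into itself one cyclic summand at a time, in decreasing order: an
  embedding of \<open>A\<close> extends to \<open>A \<oplus> \<langle>e\<rangle>\<close> with \<open>e\<close> of order \<open>p^k\<close> by sending \<open>e\<close> to any \<open>y\<close> with
  \<open>p^k y = 0\<close> whose multiple \<open>p^(k-1) y\<close> is not in the image of \<open>A\<close>.

  In a finite version of the identity, the term of \<open>mu\<close> is divided by \<open>(t)_(n - size mu)\<close>, the term of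
  \<open>nu\<close> by \<open>(t)_(n - size nu)\<close>, and the infinite product is replaced by \<open>(1 - t z) \<dots> (1 - t^n z)\<close>. Both
  sides satisfy the same recursion on the length of the first column; on the right this is a terminating
  q-series identity. Only the empty first column keeps the degree in \<open>z\<close>, so the recursion determines
  the series. The theorem is the limit \<open>n \<rightarrow> \<infinity>\<close>, after multiplication by \<open>(t)_n\<close>.
\<close>

section \<open>Embeddings into a finite abelian group\<close>

text \<open>If \<open>p^(k+1)\<close> does not divide \<open>n\<close>, the gcd of the two is
  \<open>p^i\<close> with \<open>i \<le> k\<close>. Bezout puts \<open>y^(p^i)\<close> into
  \<open>A\<close>, and raising to the power \<open>p^(k-i)\<close> puts \<open>y^(p^k)\<close>
  there, against \<open>notin\<close>.\<close>

lemma (in group) int_pow_mem_subgroup_iff: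
  assumes p: "prime (p::nat)" and A: "subgroup A G" and y: "y \<in> carrier G"
    and tors: "y [^] (p ^ Suc k) = \<one>" and notin: "y [^] (p ^ k) \<notin> A"
  shows "y [^] (n::int) \<in> A \<longleftrightarrow> int (p ^ Suc k) dvd n"
proof
  assume "int (p ^ Suc k) dvd n"
  then obtain m where "n = int (p ^ Suc k) * m" by (auto elim: dvdE)
  then have "y [^] n = (y [^] int (p ^ Suc k)) [^] m" using y by (simp add: int_pow_pow)
  also have "\<dots> = \<one>" using tors by (simp only: int_pow_int int_pow_one)
  finally show "y [^] n \<in> A" using A by (simp add: subgroup.one_closed)
next
  assume mem: "y [^] n \<in> A"
  show "int (p ^ Suc k) dvd n"
  proof (rule ccontr)
    assume ndvd: "\<not> int (p ^ Suc k) dvd n"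
    define d where "d = gcd n (int (p ^ Suc k))"
    have "nat d dvd p ^ Suc k" by (metis d_def gcd_dvd2 gcd_ge_0_int nat_dvd_iff)
    then obtain i where i: "i \<le> Suc k" "nat d = p ^ i" using divides_primepow_nat[OF p] by metis
    then have di: "d = int (p ^ i)" by (metis d_def gcd_ge_0_int int_nat_eq)
    have "i \<noteq> Suc k" using ndvd di by (metis d_def gcd_dvd1)
    then have ik: "i \<le> k" using i by simp
    obtain u v where uv: "u * n + v * int (p ^ Suc k) = d" unfolding d_def using bezout_int by blast
    have "y [^] d = (y [^] n) [^] u \<otimes> (y [^] int (p ^ Suc k)) [^] v"
      using y uv by (simp add: int_pow_pow int_pow_mult[symmetric] mult.commute)
    also have "(y [^] int (p ^ Suc k)) = \<one>" using tors by (simp only: int_pow_int)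
    finally have "y [^] d = (y [^] n) [^] u" using y by simp
    then have "y [^] (p ^ i) \<in> A"
      using mem A di by (metis int_pow_int subgroup.mem_carrier subgroup_int_pow_closed)
    then have "(y [^] (p ^ i)) [^] (p ^ (k - i)) \<in> A"
      using A by (metis subgroup_int_pow_closed int_pow_int)
    then show False using notin y ik by (simp add: nat_pow_pow power_add[symmetric])
  qed
qed

text \<open>An equality puts \<open>y^(n-m)\<close> into \<open>A\<close>, which forces it to be
  trivial. So \<open>A\<close> and the cyclic group of \<open>y\<close> meet trivially; this is
  applied to \<open>e\<close> over \<open>A\<close> and to \<open>y\<close> over the image of
  \<open>A\<close>.\<close>

lemma (in group) mult_int_pow_eq_iff:
  assumes p: "prime (p::nat)" and A: "subgroup A G" and y: "y \<in> carrier G"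
    and tors: "y [^] (p ^ Suc k) = \<one>" and notin: "y [^] (p ^ k) \<notin> A"
    and a: "a \<in> A" and b: "b \<in> A"
  shows "a \<otimes> y [^] (n::int) = b \<otimes> y [^] (m::int) \<longleftrightarrow> a = b \<and> int (p ^ Suc k) dvd n - m"
proof -
  have ac: "a \<in> carrier G" "b \<in> carrier G" using a b A by (auto simp: subgroup.mem_carrier)
  have 1: "y [^] n = y [^] (n - m) \<otimes> y [^] m" using y by (simp add: int_pow_mult[symmetric])
  show ?thesis
  proof
    assume eq: "a \<otimes> y [^] n = b \<otimes> y [^] m"
    then have "(a \<otimes> y [^] (n - m)) \<otimes> y [^] m = b \<otimes> y [^] m"
      using ac y 1 by (simp add: m_assoc)
    then have e: "a \<otimes> y [^] (n - m) = b" using ac y by simp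
    then have "y [^] (n - m) = inv a \<otimes> b" using ac y by (metis int_pow_closed inv_solve_left)
    then have "y [^] (n - m) \<in> A" using a b A by (simp add: subgroup.m_closed subgroup.m_inv_closed)
    then have d: "int (p ^ Suc k) dvd n - m"
      using int_pow_mem_subgroup_iff[OF p A y tors notin] by simp
    then have "y [^] (n - m) = \<one>"
      using tors y by (metis dvdE int_pow_int int_pow_one int_pow_pow)
    then show "a = b \<and> int (p ^ Suc k) dvd n - m" using d e ac by simp
  next
    assume r: "a = b \<and> int (p ^ Suc k) dvd n - m"
    then have "y [^] (n - m) = \<one>"
      using tors y by (metis dvdE int_pow_int int_pow_one int_pow_pow)
    then show "a \<otimes> y [^] n = b \<otimes> y [^] m" using r 1 y by simp
  qed
qed

text \<open>Extensional functions, so that each embedding is counted once and the case of the whole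
  carrier can be compared with \<open>auto\<close>.\<close>

definition embeddings :: "('a, 'b) monoid_scheme \<Rightarrow> 'a set \<Rightarrow> ('a \<Rightarrow> 'a) set" where
  "embeddings G A = {f \<in> A \<rightarrow>\<^sub>E carrier G. inj_on f A \<and>
     (\<forall>x\<in>A. \<forall>y\<in>A. f (x \<otimes>\<^bsub>G\<^esub> y) = f x \<otimes>\<^bsub>G\<^esub> f y)}"

lemma (in group) embedding_group_hom:
  assumes "f \<in> embeddings G A" "subgroup A G"
  shows "group_hom (G\<lparr>carrier := A\<rparr>) G f"
  using assms subgroup.subgroup_is_group[OF assms(2) is_group]
  by (intro group_hom.intro group_hom_axioms.intro is_group)
     (auto simp: embeddings_def hom_def PiE_iff)

lemma (in group) embedding_image_subgroup:
  assumes "f \<in> embeddings G A" "subgroup A G"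
  shows "subgroup (f ` A) G"
  using group_hom.img_is_subgroup[OF embedding_group_hom[OF assms]] by simp

lemma (in group) embedding_one:
  assumes "f \<in> embeddings G A" "subgroup A G"
  shows "f \<one> = \<one>"
  using group_hom.hom_one[OF embedding_group_hom[OF assms]] by simp

lemma (in group) embedding_int_pow:
  assumes "f \<in> embeddings G A" "subgroup A G" "x \<in> A"
  shows "f (x [^] (n::int)) = f x [^] n"
  using group_hom.hom_int_pow[OF embedding_group_hom[OF assms(1,2)], of x n]
    int_pow_consistent[OF assms(2,3), of n] assms(3) by simp

lemma (in group) embedding_nat_pow:
  assumes "f \<in> embeddings G A" "subgroup A G" "x \<in> A"
  shows "f (x [^] (n::nat)) = f x [^] n"
  using embedding_int_pow[OF assms, of "int n"] by (simp add: int_pow_int)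

text \<open>The hypotheses on \<open>e\<close> say that \<open>B\<close> is the internal direct sum of \<open>A\<close> and a cyclic group of order
  \<open>p ^ Suc k\<close>; those on \<open>y\<close> say the same of the image, because a nontrivial subgroup of \<open>\<langle>y\<rangle>\<close> contains
  \<open>y [^] p ^ k\<close>.\<close>

lemma (in comm_group) bij_betw_embeddings_adjoin:
  assumes p: "prime (p::nat)" and A: "subgroup A G" and e: "e \<in> carrier G"
    and tors: "e [^] (p ^ Suc k) = \<one>" and notin: "e [^] (p ^ k) \<notin> A"
    and B: "subgroup B G" and B_def: "B = {a \<otimes> e [^] n | a n. a \<in> A \<and> n \<in> (UNIV::int set)}"
  shows "bij_betw (\<lambda>f. (restrict f A, f e)) (embeddings G B)
    (SIGMA f:embeddings G A. {y \<in> carrier G. y [^] (p ^ Suc k) = \<one> \<and> y [^] (p ^ k) \<notin> f ` A})"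
    (is "bij_betw ?F ?E ?S")
proof -
  have Ac: "a \<in> carrier G" if "a \<in> A" for a using that A by (simp add: subgroup.mem_carrier)
  have AB: "A \<subseteq> B"
  proof
    fix a assume "a \<in> A"
    then have "a = a \<otimes> e [^] (0::int)" using Ac by simp
    then show "a \<in> B" unfolding B_def using \<open>a \<in> A\<close> by blast
  qed
  have "e = \<one> \<otimes> e [^] (1::int)" using e by (simp add: int_pow_1)
  then have eB: "e \<in> B" unfolding B_def using A subgroup.one_closed by blast
  have eB': "e [^] (n::int) \<in> B" for n
    using eB B by (rule subgroup_int_pow_closed[rotated])
  \<comment> \<open>An embedding of \<open>B\<close> is thereby determined by its restriction to
    \<open>A\<close> and its value at \<open>e\<close>.\<close>
  have dec: "f (a \<otimes> e [^] n) = f a \<otimes> f e [^] n" if "f \<in> ?E" "a \<in> A" for f a and n :: int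
  proof -
    have "f (a \<otimes> e [^] n) = f a \<otimes> f (e [^] n)"
      using that AB eB' by (auto simp: embeddings_def)
    then show ?thesis using embedding_int_pow[OF that(1) B eB] by simp
  qed
  show ?thesis
  proof (rule bij_betw_imageI)
    show "inj_on ?F ?E"
    proof (rule inj_onI)
      fix f g assume f: "f \<in> ?E" and g: "g \<in> ?E" and eq: "?F f = ?F g"
      have "f a = g a" if "a \<in> A" for a using eq that by (metis Pair_inject restrict_apply')
      then have "f x = g x" if "x \<in> B" for x
        using that eq dec[OF f] dec[OF g] unfolding B_def by auto
      then show "f = g"
        using f g by (intro PiE_ext[of f B "\<lambda>_. carrier G" g]) (auto simp only: embeddings_def mem_Collect_eq)
    qed
    show "?F ` ?E = ?S"
    proof safe
      fix f assume f: "f \<in> ?E"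
      show "restrict f A \<in> embeddings G A"
        using f AB A by (auto simp: embeddings_def PiE_iff subgroup.m_closed intro: inj_on_subset)
      show "f e \<in> carrier G" using f eB by (auto simp: embeddings_def)
      have "f e [^] (p ^ Suc k) = f (e [^] (p ^ Suc k))" by (rule embedding_nat_pow[OF f B eB, symmetric])
      then show "f e [^] (p ^ Suc k) = \<one>" using tors embedding_one[OF f B] by simp
    next
      fix f a assume f: "f \<in> ?E" and a: "f e [^] (p ^ k) = restrict f A a" "a \<in> A"
      have "f (e [^] (p ^ k)) = f a" using a embedding_nat_pow[OF f B eB] by simp
      moreover have "e [^] (p ^ k) \<in> B" using eB' by (metis int_pow_int)
      ultimately have "e [^] (p ^ k) = a" using f a AB by (auto simp: embeddings_def dest: inj_onD)
      then show False using a notin by simp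
    next
      fix f y assume f: "f \<in> embeddings G A" and y: "y \<in> carrier G" and yt: "y [^] (p ^ Suc k) = \<one>"
        and yn: "y [^] (p ^ k) \<notin> f ` A"
      note sub = embedding_image_subgroup[OF f A]
      have fc: "f a \<in> carrier G" if "a \<in> A" for a using f that by (auto simp: embeddings_def)
      \<comment> \<open>As \<open>f\<close> is injective, both equations amount to
        \<open>a = b\<close> and \<open>int (p ^ Suc k) dvd n - m\<close>. One direction makes the
        extension well defined, the other makes it injective.\<close>
      have key: "f a \<otimes> y [^] n = f b \<otimes> y [^] m \<longleftrightarrow> a \<otimes> e [^] n = b \<otimes> e [^] m"
        if "a \<in> A" "b \<in> A" for a b and n m :: int
      proof -
        have "f a = f b \<longleftrightarrow> a = b" using f that by (auto simp: embeddings_def dest: inj_onD)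
        then show ?thesis
          using mult_int_pow_eq_iff[OF p A e tors notin that, of n m]
            mult_int_pow_eq_iff[OF p sub y yt yn, of "f a" "f b" n m] that by blast
      qed
      \<comment> \<open>The only possible extension; it is given by a description because
        \<open>n\<close> is determined only modulo \<open>p^(k+1)\<close>.\<close>
      define g where "g = (\<lambda>x\<in>B. THE z. \<exists>a\<in>A. \<exists>n::int. x = a \<otimes> e [^] n \<and> z = f a \<otimes> y [^] n)"
      have g: "g (a \<otimes> e [^] n) = f a \<otimes> y [^] n" if a: "a \<in> A" for a and n :: int
      proof -
        have "a \<otimes> e [^] n \<in> B" unfolding B_def using a by blast
        moreover have "(THE z. \<exists>b\<in>A. \<exists>m::int. a \<otimes> e [^] n = b \<otimes> e [^] m \<and> z = f b \<otimes> y [^] m)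
           = f a \<otimes> y [^] n"
        proof (rule the_equality)
          show "\<exists>b\<in>A. \<exists>m::int. a \<otimes> e [^] n = b \<otimes> e [^] m \<and> f a \<otimes> y [^] n = f b \<otimes> y [^] m"
            using a by blast
          fix z assume "\<exists>b\<in>A. \<exists>m::int. a \<otimes> e [^] n = b \<otimes> e [^] m \<and> z = f b \<otimes> y [^] m"
          then obtain b m where "b \<in> A" "a \<otimes> e [^] n = b \<otimes> e [^] (m::int)" "z = f b \<otimes> y [^] m"
            by blast
          then show "z = f a \<otimes> y [^] n" using key[OF a, of b n m] by simp
        qed
        ultimately show ?thesis by (simp add: g_def)
      qed
      have gA: "g a = f a" if "a \<in> A" for a using g[OF that, of 0] that Ac fc by simp
      have "f \<one> = \<one>" using embedding_one[OF f A] .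
      then have ge: "g e = y" using g[of \<one> 1] A e y by (simp add: subgroup.one_closed int_pow_1)
      have gB: "g \<in> embeddings G B" unfolding embeddings_def
      proof (intro CollectI conjI ballI)
        show "g \<in> B \<rightarrow>\<^sub>E carrier G"
        proof
          fix x assume "x \<in> B" then show "g x \<in> carrier G" unfolding B_def using g fc y by auto
        qed (simp add: g_def)
        show "inj_on g B"
        proof (rule inj_onI)
          fix u v assume "u \<in> B" "v \<in> B" and eq: "g u = g v"
          then obtain a b n m where "a \<in> A" "b \<in> A" "u = a \<otimes> e [^] (n::int)" "v = b \<otimes> e [^] (m::int)"
            unfolding B_def by blast
          then show "u = v" using eq key g by simp
        qed
        fix u v assume "u \<in> B" "v \<in> B"
        then obtain a b n m where ab: "a \<in> A" "b \<in> A" "u = a \<otimes> e [^] (n::int)" "v = b \<otimes> e [^] (m::int)"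
          unfolding B_def by blast
        have mix: "(s \<otimes> w [^] n) \<otimes> (t \<otimes> w [^] m) = (s \<otimes> t) \<otimes> w [^] (n + m)"
          if "s \<in> carrier G" "t \<in> carrier G" "w \<in> carrier G" for s t w
          using that by (simp add: int_pow_mult m_ac)
        have "u \<otimes> v = (a \<otimes> b) \<otimes> e [^] (n + m)" using ab mix Ac e by simp
        then have "g (u \<otimes> v) = f (a \<otimes> b) \<otimes> y [^] (n + m)"
          using g ab A by (simp add: subgroup.m_closed)
        also have "f (a \<otimes> b) = f a \<otimes> f b" using f ab by (simp add: embeddings_def)
        also have "(f a \<otimes> f b) \<otimes> y [^] (n + m) = g u \<otimes> g v" using ab mix fc y g by simp
        finally show "g (u \<otimes> v) = g u \<otimes> g v" .
      qed
      have "?F g = (f, y)"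
        using ge gA f by (auto simp: embeddings_def fun_eq_iff PiE_iff extensional_def)
      from image_eqI[of "(f, y)" ?F, OF this[symmetric] gB] show "(f, y) \<in> ?F ` ?E" .
    qed
  qed
qed

text \<open>The solutions form a coset of the kernel of the n-th power map, with representative
  \<open>w\<close>.\<close>

lemma (in comm_group) card_root_fibre:
  assumes "w \<in> carrier G" "w [^] n = (x::'a)"
  shows "card {y \<in> carrier G. y [^] (n::nat) = x} = card (torsion G n)"
proof -
  have "bij_betw (\<lambda>t. w \<otimes> t) (torsion G n) {y \<in> carrier G. y [^] n = x}"
  proof (rule bij_betwI[where g = "\<lambda>y. inv w \<otimes> y"])
    show "(\<otimes>) w \<in> torsion G n \<rightarrow> {y \<in> carrier G. y [^] n = x}"
      using assms by (auto simp: torsion_def pow_mult_distrib m_comm)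
    show "(\<otimes>) (inv w) \<in> {y \<in> carrier G. y [^] n = x} \<rightarrow> torsion G n"
      using assms by (auto simp: torsion_def pow_mult_distrib m_comm nat_pow_inv)
  qed (use assms in \<open>auto simp: torsion_def m_assoc[symmetric]\<close>)
  then show ?thesis by (simp add: bij_betw_same_card)
qed

text \<open>By the bijection above it suffices that every \<open>f\<close> admits equally many
  images \<open>y\<close> of \<open>e\<close>. From the \<open>p^(k+1)\<close>-torsion one removes
  the \<open>y\<close> whose power \<open>y^(p^k)\<close> lies in the image of \<open>A\<close>.
  Such a power is killed by \<open>p\<close>, so it comes from the \<open>p\<close>-torsion of
  \<open>A\<close>, and the removed set is a union of fibres of the power map, one for each element
  of that torsion.\<close>

lemma (in comm_group) card_embeddings_adjoin:
  assumes fin: "finite (carrier G)" and p: "prime (p::nat)" and A: "subgroup A G" and e: "e \<in> carrier G"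
    and tors: "e [^] (p ^ Suc k) = \<one>" and notin: "e [^] (p ^ k) \<notin> A"
    and B: "subgroup B G" and B_def: "B = {a \<otimes> e [^] n | a n. a \<in> A \<and> n \<in> (UNIV::int set)}"
    and roots: "\<And>x. x \<in> A \<Longrightarrow> x [^] p = \<one> \<Longrightarrow> \<exists>y\<in>A. y [^] (p ^ k) = x"
  shows "card (embeddings G B) = card (embeddings G A) *
    (card (torsion G (p ^ Suc k)) - card {x \<in> A. x [^] p = \<one>} * card (torsion G (p ^ k)))"
proof -
  have finA: "finite A" using A fin finite_subset subgroup.subset by blast
  have "card {y \<in> carrier G. y [^] (p ^ Suc k) = \<one> \<and> y [^] (p ^ k) \<notin> f ` A} =
     card (torsion G (p ^ Suc k)) - card {x \<in> A. x [^] p = \<one>} * card (torsion G (p ^ k))"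
    if f: "f \<in> embeddings G A" for f
  proof -
    define T where "T = {x \<in> A. x [^] p = \<one>}"
    have fc: "f a \<in> carrier G" if "a \<in> A" for a using f that by (auto simp: embeddings_def)
    have inj: "inj_on f A" using f by (auto simp: embeddings_def)
    have pk: "y [^] (p ^ Suc k) = (y [^] (p ^ k)) [^] p" if "y \<in> carrier G" for y
      using that by (simp add: nat_pow_pow mult.commute)
    have "{y \<in> carrier G. y [^] (p ^ Suc k) = \<one> \<and> y [^] (p ^ k) \<in> f ` A}
      = (\<Union>x\<in>T. {y \<in> carrier G. y [^] (p ^ k) = f x})" (is "?L = ?R")
    proof safe
      fix y x assume "y \<in> carrier G" "y [^] (p ^ Suc k) = \<one>" "y [^] (p ^ k) = f x" "x \<in> A"
      then have "f (x [^] p) = f \<one>" using pk embedding_nat_pow[OF f A] embedding_one[OF f A] by simp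
      moreover have "x [^] p \<in> A" using A \<open>x \<in> A\<close> by (metis int_pow_int subgroup_int_pow_closed)
      ultimately have "x [^] p = \<one>" using inj A by (meson inj_onD subgroup.one_closed)
      then show "y \<in> ?R" using \<open>x \<in> A\<close> \<open>y \<in> carrier G\<close> \<open>y [^] (p ^ k) = f x\<close> by (auto simp: T_def)
    next
      fix y x assume "y \<in> carrier G" "x \<in> T" "y [^] (p ^ k) = f x"
      moreover from this have "f (x [^] p) = f x [^] p" by (intro embedding_nat_pow[OF f A]) (simp add: T_def)
      ultimately have "y [^] (p ^ Suc k) = \<one>" using pk embedding_one[OF f A] by (simp add: T_def)
      then show "y [^] (p ^ Suc k) = \<one>" by simp
    qed (auto simp: T_def)
    moreover have "card ?R = (\<Sum>x\<in>T. card {y \<in> carrier G. y [^] (p ^ k) = f x})"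
      by (rule card_UN_disjoint) (use finA fin inj in \<open>auto simp: T_def dest: inj_onD\<close>)
    \<comment> \<open>Here \<open>roots\<close> enters: \<open>f\<close> carries a root of
      \<open>x\<close> in \<open>A\<close> to a root of \<open>f x\<close>, so the fibre is nonempty
      and hence a full coset.\<close>
    moreover have "card {y \<in> carrier G. y [^] (p ^ k) = f x} = card (torsion G (p ^ k))" if xT: "x \<in> T" for x
    proof -
      obtain w where "w \<in> A" "w [^] (p ^ k) = x" using xT roots by (auto simp: T_def)
      then show ?thesis using card_root_fibre[of "f w" "p ^ k" "f x"] fc embedding_nat_pow[OF f A, of w "p ^ k"] by simp
    qed
    ultimately have cL: "card ?L = card T * card (torsion G (p ^ k))" by simp
    have "{y \<in> carrier G. y [^] (p ^ Suc k) = \<one> \<and> y [^] (p ^ k) \<notin> f ` A} = torsion G (p ^ Suc k) - ?L"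
      by (auto simp: torsion_def)
    moreover have "?L \<subseteq> torsion G (p ^ Suc k)" by (auto simp: torsion_def)
    moreover have "finite ?L" using fin by simp
    ultimately show ?thesis using cL by (simp only: card_Diff_subset T_def)
  qed
  moreover have "finite (embeddings G A)"
    by (rule finite_subset[of _ "A \<rightarrow>\<^sub>E carrier G"]) (use finA fin in \<open>auto simp: embeddings_def intro: finite_PiE\<close>)
  ultimately show ?thesis
    using bij_betw_same_card[OF bij_betw_embeddings_adjoin[OF p A e tors notin B B_def]] fin
    by (simp add: card_SigmaI)
qed

text \<open>An injective self-map of a finite set is surjective.\<close>

lemma auto_eq_embeddings:
  assumes "finite (carrier G)"
  shows "auto G = embeddings G (carrier G)"
  using endo_inj_surj[OF assms]
  by (auto simp: auto_def embeddings_def Bij_def hom_def bij_betw_def PiE_def Pi_iff image_subset_iff)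

section \<open>Automorphisms of a finite abelian p-group of given type\<close>

definition pgroup_index :: "nat multiset \<Rightarrow> (nat \<times> nat) set" where
  "pgroup_index mu = (SIGMA i:set_mset mu. {..<count mu i})"

text \<open>The internal direct sum of the cyclic summands indexed by \<open>J\<close>. These are
  the subgroups \<open>A\<close> and \<open>B\<close> when summands are adjoined one at a
  time.\<close>

definition pgroup_supp :: "nat \<Rightarrow> nat multiset \<Rightarrow> (nat \<times> nat) set \<Rightarrow> (nat \<times> nat \<Rightarrow> int) set" where
  "pgroup_supp p mu J = {x \<in> carrier (pgroup p mu). \<forall>s\<in>pgroup_index mu - J. x s = 0}"

lemma finite_pgroup_index [simp]: "finite (pgroup_index mu)"
  by (simp add: pgroup_index_def)

lemma pgroup_index_pos: "int_partition mu \<Longrightarrow> s \<in> pgroup_index mu \<Longrightarrow> 0 < fst s"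
  by (cases s) (auto simp: pgroup_index_def int_partition_def intro: gr0I)

lemma pgroup_alt:
  "pgroup p mu = sum_group (pgroup_index mu) (\<lambda>s. integer_mod_group (p ^ fst s))"
  by (simp add: pgroup_def pgroup_index_def case_prod_unfold)

lemma carrier_pgroup:
  assumes "p > 0"
  shows "carrier (pgroup p mu) = (\<Pi>\<^sub>E s\<in>pgroup_index mu. {0..<int (p ^ fst s)})"
  using assms by (simp add: pgroup_alt carrier_sum_group carrier_integer_mod_group cong: PiE_cong)

lemma finite_carrier_pgroup: "p > 0 \<Longrightarrow> finite (carrier (pgroup p mu))"
  by (simp add: carrier_pgroup finite_PiE)

lemma mult_pgroup:
  "x \<otimes>\<^bsub>pgroup p mu\<^esub> y = (\<lambda>s\<in>pgroup_index mu. (x s + y s) mod int (p ^ fst s))"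
  by (simp add: pgroup_alt)

lemma one_pgroup: "\<one>\<^bsub>pgroup p mu\<^esub> = (\<lambda>s\<in>pgroup_index mu. 0)"
  by (simp add: pgroup_alt)

lemma comm_group_pgroup: "comm_group (pgroup p mu)"
proof -
  interpret group "pgroup p mu" by (simp add: pgroup_alt)
  show ?thesis by (rule group_comm_groupI) (simp add: mult_pgroup add.commute)
qed

lemma nat_pow_pgroup:
  assumes "p > 0" "x \<in> carrier (pgroup p mu)"
  shows "x [^]\<^bsub>pgroup p mu\<^esub> (n::nat) = (\<lambda>s\<in>pgroup_index mu. int n * x s mod int (p ^ fst s))"
proof -
  interpret comm_group "pgroup p mu" by (rule comm_group_pgroup)
  show ?thesis
    by (induction n)
       (auto simp: one_pgroup mult_pgroup fun_eq_iff restrict_def algebra_simps mod_add_right_eq)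
qed

lemma pgroup_supp_iff:
  assumes "p > 0"
  shows "x \<in> pgroup_supp p mu J \<longleftrightarrow> x \<in> extensional (pgroup_index mu) \<and>
    (\<forall>s\<in>pgroup_index mu. 0 \<le> x s \<and> x s < int (p ^ fst s) \<and> (s \<notin> J \<longrightarrow> x s = 0))"
  using assms by (auto simp: pgroup_supp_def carrier_pgroup PiE_iff)

lemma subgroup_pgroup_supp:
  assumes p: "p > 0"
  shows "subgroup (pgroup_supp p mu J) (pgroup p mu)"
proof -
  interpret comm_group "pgroup p mu" by (rule comm_group_pgroup)
  show ?thesis
  proof (rule subgroupI)
    have "\<one>\<^bsub>pgroup p mu\<^esub> \<in> pgroup_supp p mu J"
      by (simp add: pgroup_supp_def) (simp add: one_pgroup)
    then show "pgroup_supp p mu J \<noteq> {}" by blast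
    fix x assume x: "x \<in> pgroup_supp p mu J"
    define z where "z = inv\<^bsub>pgroup p mu\<^esub> x"
    have z: "z \<in> carrier (pgroup p mu)" "x \<otimes>\<^bsub>pgroup p mu\<^esub> z = \<one>\<^bsub>pgroup p mu\<^esub>"
      using x by (simp_all add: pgroup_supp_def z_def)
    have "z s = 0" if s: "s \<in> pgroup_index mu - J" for s
    proof -
      have "z s mod int (p ^ fst s) = 0"
        using fun_cong[OF z(2), of s] s x by (simp add: mult_pgroup one_pgroup pgroup_supp_def)
      moreover have "z s \<in> {0..<int (p ^ fst s)}"
        using z(1) s unfolding carrier_pgroup[OF p] by (auto simp only: PiE_iff)
      ultimately show "z s = 0" by simp
    qed
    then show "inv\<^bsub>pgroup p mu\<^esub> x \<in> pgroup_supp p mu J" using z(1) unfolding z_def[symmetric] by (simp add: pgroup_supp_def)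
  qed (use p in \<open>auto simp: pgroup_supp_def mult_pgroup carrier_pgroup PiE_iff extensional_def\<close>)
qed

text \<open>The set is the \<open>p^k\<close>-torsion of the cyclic group of order
  \<open>p^i\<close>: everything if \<open>i \<le> k\<close>, and otherwise the multiples of
  \<open>p^(i-k)\<close>.\<close>

lemma card_pow_multiples:
  assumes p: "p > (0::nat)"
  shows "card {a \<in> {0..<int (p ^ i)}. int (p ^ k) * a mod int (p ^ i) = 0} = p ^ min k i"
proof (cases "i \<le> k")
  case True
  then have "int (p ^ k) * a mod int (p ^ i) = 0" for a
    by (metis dvd_eq_mod_eq_0 dvd_mult2 le_imp_power_dvd of_nat_dvd_iff)
  then have "{a \<in> {0..<int (p ^ i)}. int (p ^ k) * a mod int (p ^ i) = 0} = {0..<int (p ^ i)}" by auto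
  then show ?thesis using True by (simp only: card_atLeastLessThan_int diff_zero nat_int min_absorb2)
next
  case False
  define d where "d = int (p ^ (i - k))"
  have d: "int (p ^ i) = int (p ^ k) * d" using False by (simp add: d_def flip: power_add)
  have pos: "d > 0" "int (p ^ k) > 0" using p by (simp_all add: d_def)
  have "{a \<in> {0..<int (p ^ i)}. int (p ^ k) * a mod int (p ^ i) = 0} = (\<lambda>b. d * b) ` {0..<int (p ^ k)}"
  proof (intro equalityI subsetI)
    fix a assume "a \<in> {a \<in> {0..<int (p ^ i)}. int (p ^ k) * a mod int (p ^ i) = 0}"
    then have a: "a \<in> {0..<int (p ^ i)}" "int (p ^ k) * a mod int (p ^ i) = 0" by blast+
    then have "int (p ^ k) * d dvd int (p ^ k) * a" unfolding d by (simp only: mod_eq_0_iff_dvd)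
    then have "d dvd a" using pos by (metis dvd_mult_cancel_left less_irrefl)
    then obtain b where b: "a = d * b" by (auto elim: dvdE)
    then have "0 \<le> b" using a pos by (simp add: zero_le_mult_iff)
    moreover have "d * b < d * int (p ^ k)" using a b d by (simp add: mult.commute)
    then have "b < int (p ^ k)" using pos by (simp only: mult_less_cancel_left_pos)
    ultimately show "a \<in> (\<lambda>b. d * b) ` {0..<int (p ^ k)}" using b by auto
  next
    fix a assume "a \<in> (\<lambda>b. d * b) ` {0..<int (p ^ k)}"
    then obtain b where b: "b \<in> {0..<int (p ^ k)}" and a: "a = d * b" by blast
    then have "d * b < d * int (p ^ k)" using pos by (simp only: mult_less_cancel_left_pos) simp
    then have "a \<in> {0..<int (p ^ i)}" using pos b d a by (simp add: mult.commute)
    moreover have "int (p ^ k) * a mod int (p ^ i) = 0" unfolding d a by (simp flip: mult.assoc)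
    ultimately show "a \<in> {a \<in> {0..<int (p ^ i)}. int (p ^ k) * a mod int (p ^ i) = 0}" by blast
  qed
  moreover have "inj_on (\<lambda>b. d * b) {0..<int (p ^ k)}" using pos by (intro inj_onI) simp
  ultimately have "card {a \<in> {0..<int (p ^ i)}. int (p ^ k) * a mod int (p ^ i) = 0} = nat (int (p ^ k))"
    by (simp only: card_image card_atLeastLessThan_int diff_zero)
  then show ?thesis using False by (simp only: nat_int min_absorb1 linear)
qed

text \<open>The torsion condition is coordinatewise and the coordinates outside \<open>J\<close> are
  0, so restriction to \<open>J\<close> is a bijection onto a product of torsion subgroups of cyclic
  groups.\<close>

lemma card_torsion_pgroup_supp:
  assumes p: "p > 0" and J: "J \<subseteq> pgroup_index mu"
  shows "card {x \<in> pgroup_supp p mu J. x [^]\<^bsub>pgroup p mu\<^esub> (p ^ k) = \<one>\<^bsub>pgroup p mu\<^esub>}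
     = p ^ (\<Sum>s\<in>J. min k (fst s))"
proof -
  let ?D = "\<lambda>s. {a \<in> {0..<int (p ^ fst s)}. int (p ^ k) * a mod int (p ^ fst s) = 0}"
  let ?I = "pgroup_index mu"
  have eq: "x \<in> {x \<in> pgroup_supp p mu J. x [^]\<^bsub>pgroup p mu\<^esub> (p ^ k) = \<one>\<^bsub>pgroup p mu\<^esub>} \<longleftrightarrow>
     x \<in> extensional ?I \<and> (\<forall>s\<in>?I. x s \<in> ?D s \<and> (s \<notin> J \<longrightarrow> x s = 0))" for x
  proof -
    have "x [^]\<^bsub>pgroup p mu\<^esub> (p ^ k) = \<one>\<^bsub>pgroup p mu\<^esub> \<longleftrightarrow>
        (\<forall>s\<in>?I. int (p ^ k) * x s mod int (p ^ fst s) = 0)" if "x \<in> pgroup_supp p mu J"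
      using that p nat_pow_pgroup[OF p, of x mu "p ^ k"]
      by (auto simp: pgroup_supp_def one_pgroup fun_eq_iff restrict_def split: if_splits)
    then show ?thesis unfolding mem_Collect_eq pgroup_supp_iff[OF p] by auto
  qed
  have "bij_betw (\<lambda>x. restrict x J)
     {x \<in> pgroup_supp p mu J. x [^]\<^bsub>pgroup p mu\<^esub> (p ^ k) = \<one>\<^bsub>pgroup p mu\<^esub>} (\<Pi>\<^sub>E s\<in>J. ?D s)"
  proof (rule bij_betwI[where g = "\<lambda>x. \<lambda>s\<in>?I. if s \<in> J then x s else 0"], goal_cases)
    case 1 show ?case
    proof (rule Pi_I)
      fix x assume "x \<in> {x \<in> pgroup_supp p mu J. x [^]\<^bsub>pgroup p mu\<^esub> (p ^ k) = \<one>\<^bsub>pgroup p mu\<^esub>}"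
      then show "restrict x J \<in> (\<Pi>\<^sub>E s\<in>J. ?D s)" unfolding eq using J by (auto simp: PiE_iff)
    qed
  next
    case 2 show ?case
    proof (rule Pi_I)
      fix x assume "x \<in> (\<Pi>\<^sub>E s\<in>J. ?D s)"
      then show "(\<lambda>s\<in>?I. if s \<in> J then x s else 0) \<in> {x \<in> pgroup_supp p mu J. x [^]\<^bsub>pgroup p mu\<^esub> (p ^ k) = \<one>\<^bsub>pgroup p mu\<^esub>}"
        unfolding eq using J p by (auto simp: PiE_iff)
    qed
  next
    case (3 x) then show ?case using J unfolding eq by (auto simp: fun_eq_iff restrict_def extensional_def)
  next
    case (4 x) then show ?case using J by (auto simp: fun_eq_iff restrict_def PiE_iff extensional_def)
  qed
  then have "card {x \<in> pgroup_supp p mu J. x [^]\<^bsub>pgroup p mu\<^esub> (p ^ k) = \<one>\<^bsub>pgroup p mu\<^esub>}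
     = card (\<Pi>\<^sub>E s\<in>J. ?D s)" by (rule bij_betw_same_card)
  also have "\<dots> = (\<Prod>s\<in>J. card (?D s))"
    using finite_subset[OF J] by (intro card_PiE) simp
  also have "\<dots> = (\<Prod>s\<in>J. p ^ min k (fst s))" by (simp only: card_pow_multiples[OF p])
  finally show ?thesis by (simp add: power_sum)
qed

lemma pgroup_supp_index: "pgroup_supp p mu (pgroup_index mu) = carrier (pgroup p mu)"
  by (auto simp: pgroup_supp_def)

lemma card_torsion_pgroup_sum:
  assumes p: "p > 0"
  shows "card (torsion (pgroup p mu) (p ^ k)) = p ^ (\<Sum>s\<in>pgroup_index mu. min k (fst s))"
  using card_torsion_pgroup_supp[OF p subset_refl] by (simp add: torsion_def pgroup_supp_index)

text \<open>Supplies the hypothesis \<open>roots\<close> of \<open>card_embeddings_adjoin\<close>.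
  In a cyclic group of order \<open>p^i\<close> the elements killed by \<open>p\<close> are the
  multiples of \<open>p^(i-1)\<close>; as \<open>k < i\<close>, they can be divided by
  \<open>p^k\<close>.\<close>

lemma pgroup_supp_root:
  assumes p: "p > 0" and x: "x \<in> pgroup_supp p mu J" "x [^]\<^bsub>pgroup p mu\<^esub> p = \<one>\<^bsub>pgroup p mu\<^esub>"
    and k: "\<And>s. s \<in> J \<Longrightarrow> k < fst s"
  shows "\<exists>y\<in>pgroup_supp p mu J. y [^]\<^bsub>pgroup p mu\<^esub> (p ^ k) = x"
proof -
  let ?I = "pgroup_index mu"
  define y where "y = (\<lambda>s\<in>?I. x s div int (p ^ k))"
  note xi = x(1)[unfolded pgroup_supp_iff[OF p]]
  have dvd: "int (p ^ k) dvd x s" if s: "s \<in> ?I" for s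
  proof (cases "s \<in> J")
    case True
    have "int p * x s mod int (p ^ fst s) = 0"
      using x(1) s fun_cong[OF trans[OF nat_pow_pgroup[OF p, symmetric, of x mu p] x(2)], of s]
      by (simp add: pgroup_supp_def one_pgroup)
    then have "int (p ^ Suc (fst s - 1)) dvd int p * x s"
      using k[OF True] by (simp only: mod_eq_0_iff_dvd Suc_diff_1 le_less_trans[OF le0])
    then have "int (p ^ (fst s - 1)) dvd x s" using p by simp
    moreover have "p ^ k dvd p ^ (fst s - 1)" using k[OF True] by (simp add: le_imp_power_dvd)
    ultimately show ?thesis by (meson dvd_trans int_dvd_int_iff)
  next
    case False then show ?thesis using xi s by simp
  qed
  have y: "y \<in> pgroup_supp p mu J"
    unfolding pgroup_supp_iff[OF p]
  proof (intro conjI ballI impI)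
    fix s assume s: "s \<in> ?I"
    show "0 \<le> y s" using xi s p by (simp add: y_def pos_imp_zdiv_nonneg_iff)
    have "y s \<le> x s" using xi s p unfolding y_def
      using zdiv_mono2[of "x s" 1 "int (p ^ k)"] by simp
    then show "y s < int (p ^ fst s)" using xi s by (blast intro: le_less_trans)
    show "s \<notin> J \<Longrightarrow> y s = 0" using xi s by (simp add: y_def)
  qed (simp add: y_def)
  moreover have "y [^]\<^bsub>pgroup p mu\<^esub> (p ^ k) = x"
  proof -
    have "y \<in> carrier (pgroup p mu)" using y by (simp add: pgroup_supp_def)
    moreover have "int (p ^ k) * y s = x s" if "s \<in> ?I" for s
      using dvd[OF that] that by (simp add: y_def)
    ultimately show ?thesis using nat_pow_pgroup[OF p, of y mu "p ^ k"] xi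
      by (auto simp: fun_eq_iff restrict_def extensional_def)
  qed
  ultimately show ?thesis by blast
qed

text \<open>Supplies the decomposition \<open>B_def\<close> of
  \<open>card_embeddings_adjoin\<close>, with \<open>e\<close> the standard generator of the summand
  \<open>s\<close>: the coordinate at \<open>s\<close> becomes the exponent of
  \<open>e\<close>.\<close>

lemma pgroup_supp_insert:
  assumes p: "prime p" and s: "s \<in> pgroup_index mu" and pos: "0 < fst s"
  defines "e \<equiv> \<lambda>t\<in>pgroup_index mu. if t = s then 1 else 0"
  shows "e \<in> carrier (pgroup p mu)"
    "pgroup_supp p mu (insert s J) =
      {a \<otimes>\<^bsub>pgroup p mu\<^esub> e [^]\<^bsub>pgroup p mu\<^esub> n | a n. a \<in> pgroup_supp p mu J \<and> n \<in> (UNIV::int set)}"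
proof -
  let ?I = "pgroup_index mu"
  interpret comm_group "pgroup p mu" by (rule comm_group_pgroup)
  have p0: "p > 0" and p1: "p > 1" using p prime_gt_0_nat prime_gt_1_nat by auto
  have pf: "1 < p ^ fst s" using p1 pos by (rule one_less_power)
  then have "1 < int (p ^ fst s)" by linarith
  then have esupp: "e \<in> pgroup_supp p mu (insert s J)"
    using p0 unfolding pgroup_supp_iff[OF p0] by (auto simp: e_def)
  then show e: "e \<in> carrier (pgroup p mu)" by (simp add: pgroup_supp_def)
  note sub = subgroup_pgroup_supp[OF p0]
  show "pgroup_supp p mu (insert s J) =
      {a \<otimes>\<^bsub>pgroup p mu\<^esub> e [^]\<^bsub>pgroup p mu\<^esub> n | a n. a \<in> pgroup_supp p mu J \<and> n \<in> (UNIV::int set)}"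
  proof safe
    fix x assume x: "x \<in> pgroup_supp p mu (insert s J)"
    note xi = x[unfolded pgroup_supp_iff[OF p0]]
    define a where "a = x(s := 0)"
    have a: "a \<in> pgroup_supp p mu J"
      using xi p0 s unfolding pgroup_supp_iff[OF p0] by (auto simp: a_def extensional_def)
    obtain m where m: "x s = int m" using xi s nonneg_int_cases by blast
    have "a \<otimes>\<^bsub>pgroup p mu\<^esub> e [^]\<^bsub>pgroup p mu\<^esub> m = x"
    proof (rule extensionalityI[of _ "pgroup_index mu"])
      fix t assume t: "t \<in> pgroup_index mu"
      have "x t mod int (p ^ fst t) = x t" using xi t by (intro mod_pos_pos_trivial) auto
      then show "(a \<otimes>\<^bsub>pgroup p mu\<^esub> e [^]\<^bsub>pgroup p mu\<^esub> m) t = x t"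
        using t m s unfolding mult_pgroup nat_pow_pgroup[OF p0 e] by (auto simp: a_def e_def)
    qed (use xi in \<open>auto simp: mult_pgroup\<close>)
    then have "x = a \<otimes>\<^bsub>pgroup p mu\<^esub> e [^]\<^bsub>pgroup p mu\<^esub> int m" by (simp only: int_pow_int)
    then show "\<exists>a n. x = a \<otimes>\<^bsub>pgroup p mu\<^esub> e [^]\<^bsub>pgroup p mu\<^esub> n \<and> a \<in> pgroup_supp p mu J \<and> n \<in> (UNIV::int set)"
      using a by blast
  next
    fix a n assume "a \<in> pgroup_supp p mu J"
    then have "a \<in> pgroup_supp p mu (insert s J)" by (auto simp: pgroup_supp_def)
    then show "a \<otimes>\<^bsub>pgroup p mu\<^esub> e [^]\<^bsub>pgroup p mu\<^esub> (n::int) \<in> pgroup_supp p mu (insert s J)"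
      using sub esupp by (meson subgroup.m_closed subgroup_int_pow_closed)
  qed
qed

text \<open>Induction adjoining the last, hence smallest, summand. Since the orders decrease, every
  earlier summand has order at least \<open>p^(k+1)\<close>, as \<open>pgroup_supp_root\<close>
  requires. The factor \<open>p^j\<close> counts the \<open>p\<close>-torsion of the first
  \<open>j\<close> summands.\<close>

lemma card_embeddings_pgroup_supp:
  assumes p: "prime p" and mu: "int_partition mu" and xs: "set xs \<subseteq> pgroup_index mu" "distinct xs"
    "sorted_wrt (\<ge>) (map fst xs)"
  shows "card (embeddings (pgroup p mu) (pgroup_supp p mu (set xs))) =
    (\<Prod>j<length xs. card (torsion (pgroup p mu) (p ^ fst (xs ! j)))
       - p ^ j * card (torsion (pgroup p mu) (p ^ (fst (xs ! j) - 1))))"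
  using xs
proof (induction xs rule: rev_induct)
  case Nil
  interpret comm_group "pgroup p mu" by (rule comm_group_pgroup)
  have p0: "p > 0" using p prime_gt_0_nat by auto
  have "pgroup_supp p mu {} = {\<one>\<^bsub>pgroup p mu\<^esub>}"
    unfolding set_eq_iff pgroup_supp_iff[OF p0] using p0
    by (auto simp: one_pgroup fun_eq_iff restrict_def extensional_def)
  moreover have "embeddings (pgroup p mu) {\<one>\<^bsub>pgroup p mu\<^esub>} = {\<lambda>x\<in>{\<one>\<^bsub>pgroup p mu\<^esub>}. \<one>\<^bsub>pgroup p mu\<^esub>}"
  proof (rule Set.set_eqI)
    fix f
    have "f \<one>\<^bsub>pgroup p mu\<^esub> = \<one>\<^bsub>pgroup p mu\<^esub>" if "f \<one>\<^bsub>pgroup p mu\<^esub> \<in> carrier (pgroup p mu)"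
      "f \<one>\<^bsub>pgroup p mu\<^esub> = f \<one>\<^bsub>pgroup p mu\<^esub> \<otimes>\<^bsub>pgroup p mu\<^esub> f \<one>\<^bsub>pgroup p mu\<^esub>"
      using that by simp
    then show "f \<in> embeddings (pgroup p mu) {\<one>\<^bsub>pgroup p mu\<^esub>} \<longleftrightarrow>
        f \<in> {\<lambda>x\<in>{\<one>\<^bsub>pgroup p mu\<^esub>}. \<one>\<^bsub>pgroup p mu\<^esub>}"
      by (auto simp: embeddings_def PiE_iff intro!: extensionalityI[of _ "{\<one>\<^bsub>pgroup p mu\<^esub>}"])
  qed
  ultimately show ?case by simp
next
  case (snoc s xs)
  let ?G = "pgroup p mu"
  interpret comm_group ?G by (rule comm_group_pgroup)
  have p0: "p > 0" and p1: "p > 1" using p prime_gt_0_nat prime_gt_1_nat by auto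
  have s: "s \<in> pgroup_index mu" "s \<notin> set xs" and ge: "\<And>t. t \<in> set xs \<Longrightarrow> fst s \<le> fst t"
    using snoc.prems by (auto simp: sorted_wrt_append)
  obtain k where k: "fst s = Suc k" using pgroup_index_pos[OF mu s(1)] gr0_implies_Suc by blast
  define e where "e = (\<lambda>t\<in>pgroup_index mu. if t = s then 1 else (0::int))"
  note ins = pgroup_supp_insert[OF p s(1) pgroup_index_pos[OF mu s(1)], folded e_def]
  note sub = subgroup_pgroup_supp[OF p0]
  have ek: "e [^]\<^bsub>?G\<^esub> n = (\<lambda>t\<in>pgroup_index mu. if t = s then int n mod int (p ^ Suc k) else 0)" for n :: nat
    using nat_pow_pgroup[OF p0 ins(1)] k by (auto simp: e_def fun_eq_iff)
  have tors: "e [^]\<^bsub>?G\<^esub> (p ^ Suc k) = \<one>\<^bsub>?G\<^esub>" unfolding ek by (auto simp: one_pgroup fun_eq_iff)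
  \<comment> \<open>The \<open>p^k\<close>-th power of \<open>e\<close> has the nonzero coordinate
    \<open>p^k\<close> at \<open>s\<close>, where elements supported on \<open>set xs\<close>
    vanish.\<close>
  have "int (p ^ k) < int (p ^ Suc k)" using p1 by simp
  then have "int (p ^ k) mod int (p ^ Suc k) = int (p ^ k)" by (intro mod_pos_pos_trivial) auto
  then have "(e [^]\<^bsub>?G\<^esub> (p ^ k)) s \<noteq> 0" unfolding ek using p0 s by simp
  then have notin: "e [^]\<^bsub>?G\<^esub> (p ^ k) \<notin> pgroup_supp p mu (set xs)"
    using s unfolding pgroup_supp_iff[OF p0] by metis
  have "card {x \<in> pgroup_supp p mu (set xs). x [^]\<^bsub>?G\<^esub> p = \<one>\<^bsub>?G\<^esub>} = p ^ (\<Sum>t\<in>set xs. min 1 (fst t))"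
    using card_torsion_pgroup_supp[OF p0, of "set xs" mu 1] snoc.prems by simp
  also have "(\<Sum>t\<in>set xs. min 1 (fst t)) = (\<Sum>t\<in>set xs. 1)"
  proof (rule sum.cong)
    fix t assume "t \<in> set xs"
    then show "min 1 (fst t) = 1" using ge[of t] k by simp
  qed simp
  also have "\<dots> = length xs" using snoc.prems by (simp add: distinct_card)
  finally have cA: "card {x \<in> pgroup_supp p mu (set xs). x [^]\<^bsub>?G\<^esub> p = \<one>\<^bsub>?G\<^esub>} = p ^ length xs" .
  have "card (embeddings ?G (pgroup_supp p mu (insert s (set xs)))) =
      card (embeddings ?G (pgroup_supp p mu (set xs))) *
      (card (torsion ?G (p ^ Suc k)) - p ^ length xs * card (torsion ?G (p ^ k)))"
    unfolding cA[symmetric]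
  proof (rule card_embeddings_adjoin[OF finite_carrier_pgroup[OF p0] p sub ins(1) tors notin sub ins(2)])
    fix x assume "x \<in> pgroup_supp p mu (set xs)" "x [^]\<^bsub>?G\<^esub> p = \<one>\<^bsub>?G\<^esub>"
    then show "\<exists>y\<in>pgroup_supp p mu (set xs). y [^]\<^bsub>?G\<^esub> (p ^ k) = x"
      by (rule pgroup_supp_root[OF p0]) (use ge k in fastforce)
  qed
  moreover have "card (embeddings ?G (pgroup_supp p mu (set xs))) =
    (\<Prod>j<length xs. card (torsion ?G (p ^ fst (xs ! j)))
       - p ^ j * card (torsion ?G (p ^ (fst (xs ! j) - 1))))"
    using snoc.prems by (intro snoc.IH) (auto simp: sorted_wrt_append)
  moreover have "(\<Prod>j<length xs. card (torsion ?G (p ^ fst ((xs @ [s]) ! j)))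
       - p ^ j * card (torsion ?G (p ^ (fst ((xs @ [s]) ! j) - 1)))) =
     (\<Prod>j<length xs. card (torsion ?G (p ^ fst (xs ! j)))
       - p ^ j * card (torsion ?G (p ^ (fst (xs ! j) - 1))))"
    by (intro prod.cong refl) (simp only: nth_append lessThan_iff if_True)
  moreover have "set (xs @ [s]) = insert s (set xs)" "length (xs @ [s]) = Suc (length xs)"
    "(xs @ [s]) ! length xs = s" "fst s - 1 = k" using k by simp_all
  ultimately show ?case using k by (simp only: prod.lessThan_Suc)
qed

lemma image_fst_pgroup_index: "image_mset fst (mset_set (pgroup_index mu)) = mu"
proof (rule multiset_eqI)
  fix i
  have "{s \<in> pgroup_index mu. fst s = i} = Pair i ` {..<count mu i}"
    by (auto simp: pgroup_index_def) (metis not_in_iff less_zeroE)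
  then have "card {s \<in> pgroup_index mu. fst s = i} = count mu i"
    by (simp add: card_image inj_on_def)
  then show "count (image_mset fst (mset_set (pgroup_index mu))) i = count mu i"
    by (simp add: count_image_mset_eq_card_vimage)
qed

lemma sum_pgroup_index: "(\<Sum>s\<in>pgroup_index mu. f (fst s)) = (\<Sum>i\<in>#mu. f i)"
proof -
  have "(\<Sum>i\<in>#mu. f i) = (\<Sum>i\<in>#image_mset fst (mset_set (pgroup_index mu)). f i)"
    by (simp only: image_fst_pgroup_index)
  then show ?thesis by (simp add: sum_unfold_sum_mset image_mset.compositionality comp_def)
qed

lemma card_torsion_pgroup:
  "p > 0 \<Longrightarrow> card (torsion (pgroup p mu) (p ^ k)) = p ^ (\<Sum>i\<in>#mu. min k i)"
  by (simp add: card_torsion_pgroup_sum sum_pgroup_index)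

lemma card_auto_pgroup:
  assumes p: "prime p" and mu: "int_partition mu"
  shows "card (auto (pgroup p mu)) =
    (\<Prod>j<size mu. p ^ (\<Sum>i\<in>#mu. min (nth_part mu j) i) - p ^ j * p ^ (\<Sum>i\<in>#mu. min (nth_part mu j - 1) i))"
proof -
  have p0: "p > 0" using p prime_gt_0_nat by auto
  obtain ys where ys: "set ys = pgroup_index mu" "distinct ys"
    using finite_distinct_list[OF finite_pgroup_index] by blast
  \<comment> \<open>The order among equal parts is irrelevant, because only the first components
    enter the count.\<close>
  define xs where "xs = rev (sort_key fst ys)"
  have xs: "set xs = pgroup_index mu" "distinct xs" using ys by (simp_all add: xs_def)
  have "mset xs = mset_set (pgroup_index mu)" using xs mset_set_set by metis
  then have "mset (rev (map fst xs)) = mu" by (simp add: image_fst_pgroup_index)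
  moreover have "sorted (rev (map fst xs))" by (simp add: xs_def flip: rev_map)
  ultimately have eq: "rev (map fst xs) = sorted_list_of_multiset mu"
    by (metis sorted_list_of_multiset_mset sorted_sort_id)
  then have len: "length xs = size mu" by (metis length_map length_rev size_mset mset_sorted_list_of_multiset)
  have nth: "nth_part mu j = fst (xs ! j)" if "j < length xs" for j
    using that len by (simp add: nth_part_def flip: eq)
  have "sorted_wrt (\<ge>) (map fst xs)" using \<open>sorted (rev (map fst xs))\<close> by (simp add: sorted_wrt_rev)
  then have "card (embeddings (pgroup p mu) (pgroup_supp p mu (set xs))) =
    (\<Prod>j<length xs. card (torsion (pgroup p mu) (p ^ fst (xs ! j)))
       - p ^ j * card (torsion (pgroup p mu) (p ^ (fst (xs ! j) - 1))))"
    using xs by (intro card_embeddings_pgroup_supp[OF p mu]) simp_all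
  also have "\<dots> = (\<Prod>j<size mu. p ^ (\<Sum>i\<in>#mu. min (nth_part mu j) i)
      - p ^ j * p ^ (\<Sum>i\<in>#mu. min (nth_part mu j - 1) i))"
    unfolding len[symmetric] card_torsion_pgroup[OF p0] by (intro prod.cong refl) (simp only: nth lessThan_iff)
  finally show ?thesis
    by (simp only: xs(1) auto_eq_embeddings[OF finite_carrier_pgroup[OF p0]] pgroup_supp_index)
qed

section \<open>A terminating q-series identity\<close>

text \<open>For \<open>k > n\<close> the truncated subtraction makes \<^const>\<open>qbinom\<close> nonzero.\<close>

definition gauss_binom :: "real \<Rightarrow> nat \<Rightarrow> nat \<Rightarrow> real" where
  "gauss_binom t n k = (if k \<le> n then qbinom t n k else 0)"

text \<open>For \<open>k \<le> n\<close> this is the quotient \<open>(t)_n / (t)_(n-k)\<close>. For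
  \<open>k > n\<close> it is 0, because the factor with \<open>i = n\<close> vanishes.\<close>

definition qfall :: "real \<Rightarrow> nat \<Rightarrow> nat \<Rightarrow> real" where
  "qfall t n k = (\<Prod>i<k. 1 - t ^ (n - i))"

section \<open>Gaussian binomials and q-factorials\<close>

lemma qpoch_0 [simp]: "qpoch q 0 = 1"
  by (simp add: qpoch_def)

lemma qpoch_Suc: "qpoch q (Suc n) = qpoch q n * (1 - q ^ Suc n)"
  by (simp add: qpoch_def)

lemma power_neq_1:
  fixes q :: real
  assumes "0 < q" "q \<noteq> 1" "0 < n"
  shows "q ^ n \<noteq> 1"
  using assms power_eq_imp_eq_base[of q n 1] by auto

lemma qpoch_nonzero:
  assumes "0 < q" "q \<noteq> 1"
  shows "qpoch q n \<noteq> 0"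
  using power_neq_1[OF assms] by (auto simp: qpoch_def)

lemma gauss_binom_0 [simp]: "0 < t \<Longrightarrow> t \<noteq> 1 \<Longrightarrow> gauss_binom t n 0 = 1"
  by (simp add: gauss_binom_def qbinom_def qpoch_nonzero)

text \<open>The ratio of neighbouring Gaussian binomials, cross-multiplied so that it persists for
  \<open>k \<ge> n\<close>, where both sides are 0.\<close>

lemma gauss_binom_Suc_right:
  assumes t: "0 < t" "t \<noteq> 1"
  shows "gauss_binom t n (Suc k) * (1 - t ^ Suc k) = gauss_binom t n k * (1 - t ^ (n - k))"
proof (cases "Suc k \<le> n")
  case True
  then have "n - k = Suc (n - Suc k)" by simp
  moreover have "1 - t ^ Suc j \<noteq> 0" for j using power_neq_1[OF t, of "Suc j"] by simp
  ultimately show ?thesis using True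
    by (simp add: gauss_binom_def qbinom_def qpoch_Suc qpoch_nonzero[OF t] field_simps del: power_Suc)
next
  case False
  then show ?thesis by (cases "k = n") (simp_all add: gauss_binom_def)
qed

lemma gauss_binom_Pascal:
  assumes t: "0 < t" "t \<noteq> 1" and k: "k \<le> n"
  shows "gauss_binom t (Suc n) (Suc k) = gauss_binom t n (Suc k) + t ^ (n - k) * gauss_binom t n k"
proof (cases "k = n")
  case True
  then show ?thesis by (simp add: gauss_binom_def qbinom_def qpoch_nonzero[OF t])
next
  case False
  then obtain d where d: "n = Suc (k + d)" using k by (metis less_iff_Suc_add le_neq_implies_less)
  have nz: "1 - t ^ Suc j \<noteq> 0" for j using power_neq_1[OF t, of "Suc j"] by simp
  \<comment> \<open>This splitting of the top factor of the left side produces the two terms of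
    Pascal's rule.\<close>
  have *: "1 - t ^ Suc n = (1 - t ^ Suc d) + t ^ Suc d * (1 - t ^ Suc k)"
    by (simp add: d power_add algebra_simps)
  have l: "gauss_binom t (Suc n) (Suc k) =
     qpoch t n * (1 - t ^ Suc n) / (qpoch t k * (1 - t ^ Suc k) * (qpoch t d * (1 - t ^ Suc d)))"
    by (simp add: gauss_binom_def qbinom_def d qpoch_Suc Suc_diff_le del: power_Suc)
  have r: "gauss_binom t n (Suc k) = qpoch t n / (qpoch t k * (1 - t ^ Suc k) * qpoch t d)"
    "gauss_binom t n k = qpoch t n / (qpoch t k * (qpoch t d * (1 - t ^ Suc d)))"
    by (simp_all add: gauss_binom_def qbinom_def d qpoch_Suc Suc_diff_le del: power_Suc)
  have nk: "n - k = Suc d" using d by simp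
  show ?thesis unfolding l r nk *
    using nz[of k] nz[of d] qpoch_nonzero[OF t] by (simp add: divide_simps del: power_Suc) (simp add: algebra_simps)
qed

lemma qfall_Suc: "qfall t n (Suc k) = qfall t n k * (1 - t ^ (n - k))"
  by (simp add: qfall_def)

lemma qfall_0 [simp]: "qfall t n 0 = 1"
  by (simp add: qfall_def)

lemma qfall_Suc_Suc: "qfall t (Suc n) (Suc k) = (1 - t ^ Suc n) * qfall t n k"
  by (simp add: qfall_def prod.lessThan_Suc_shift del: prod.lessThan_Suc)

lemma qfall_eq_0: "n < k \<Longrightarrow> qfall t n k = 0"
  by (auto simp: qfall_def intro!: bexI[of _ n])

lemma qpoch_eq_qfall: "k \<le> n \<Longrightarrow> qpoch t n = qfall t n k * qpoch t (n - k)"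
proof (induction k)
  case (Suc k)
  then have "n - k = Suc (n - Suc k)" by simp
  then show ?case using Suc by (simp add: qfall_Suc qpoch_Suc del: power_Suc)
qed simp

text \<open>The q-Pochhammer symbol \<open>(t^(a+1) z; t)_(n-a)\<close>. With \<open>a = 0\<close>
  it is the finite substitute for the infinite product.\<close>

definition qtail :: "real \<Rightarrow> real fps \<Rightarrow> nat \<Rightarrow> nat \<Rightarrow> real fps" where
  "qtail t z a n = (\<Prod>j=Suc a..n. 1 - fps_const (t ^ j) * z)"

lemma qtail_self [simp]: "qtail t z n n = 1"
  by (simp add: qtail_def)

lemma qtail_Suc: "a \<le> n \<Longrightarrow> qtail t z a (Suc n) = qtail t z a n * (1 - fps_const (t ^ Suc n) * z)"
  by (simp add: qtail_def)

lemma qtail_shift: "qtail t z (Suc a) (Suc n) = qtail t (fps_const t * z) a n"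
  unfolding qtail_def prod.shift_bounds_cl_Suc_ivl
  by (simp only: power_Suc2 fps_const_mult[symmetric] mult.assoc)

lemma qtail_scale: "qtail t z (c + a) (c + n) = qtail t (fps_const (t ^ c) * z) a n"
proof -
  have "qtail t z (a + c) (n + c) = qtail t (fps_const (t ^ c) * z) a n"
    unfolding qtail_def add_Suc[symmetric] prod.shift_bounds_cl_nat_ivl
    by (simp only: power_add fps_const_mult[symmetric] mult.assoc)
  then show ?thesis by (simp add: add.commute)
qed

text \<open>Both sides \<open>F(n, z)\<close> satisfy
  \<open>F(n + 1, z) = (1 - t\<^sup>n\<^sup>+\<^sup>1 z) F(n, z) + p\<^sup>m t\<^sup>n\<^sup>+\<^sup>1 z F(n, t z)\<close>, hence the induction with \<open>z\<close> arbitrary.\<close>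

lemma gauss_identity:
  assumes t: "0 < t" "t \<noteq> 1" and pt: "p * t = (1::real)"
  shows "(\<Sum>a\<le>n. fps_const (gauss_binom t n a * t ^ (a * a) * p ^ (a * m)) * z ^ a * qtail t z a n) =
    (\<Sum>b\<le>m. fps_const (gauss_binom t m b * t ^ (b * b) * p ^ (b * m) * qfall t n b) * z ^ b)"
    (is "?L n z = ?R n z")
proof (induction n arbitrary: z)
  case 0
  have "?R 0 z = (\<Sum>b\<in>{0}. fps_const (gauss_binom t m b * t ^ (b * b) * p ^ (b * m) * qfall t 0 b) * z ^ b)"
    by (rule sum.mono_neutral_right) (auto simp: qfall_eq_0)
  then show ?case using t by simp
next
  case (Suc n)
  define w where "w = fps_const t * z"
  define u where "u = fps_const (t ^ Suc n) * z"
  define c where "c = fps_const (t ^ Suc n * p ^ m) * z"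
  have "?L (Suc n) z = (1 - u) * ?L n z + c * ?L n w"
  proof -
    let ?g = "\<lambda>a. fps_const (t ^ (a * a) * p ^ (a * m)) * z ^ a * qtail t z a (Suc n)"
    let ?G = "\<lambda>n a. fps_const (gauss_binom t n a)"
    have "?L (Suc n) z = (\<Sum>a\<le>Suc n. ?G (Suc n) a * ?g a)"
      by (simp add: mult.assoc flip: fps_const_mult)
    also have "\<dots> = ?g 0 + (\<Sum>a\<le>n. ?G (Suc n) (Suc a) * ?g (Suc a))"
      using t by (subst sum.atMost_Suc_shift) simp
    \<comment> \<open>Pascal's rule splits the sum. The first part, together with
      \<open>?g 0\<close>, is the sum for \<open>n\<close> with the additional last factor
      \<open>1 - u\<close> in every tail; in the second part the shift from \<open>a\<close> to
      \<open>a + 1\<close> turns \<open>z\<close> into \<open>w\<close>.\<close>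
    also have "(\<Sum>a\<le>n. ?G (Suc n) (Suc a) * ?g (Suc a)) =
       (\<Sum>a\<le>n. ?G n (Suc a) * ?g (Suc a)) + (\<Sum>a\<le>n. fps_const (t ^ (n - a)) * ?G n a * ?g (Suc a))"
      unfolding sum.distrib[symmetric]
      by (intro sum.cong refl)
         (simp add: gauss_binom_Pascal[OF t] algebra_simps flip: fps_const_mult fps_const_add)
    also have "?g 0 + ((\<Sum>a\<le>n. ?G n (Suc a) * ?g (Suc a)) + (\<Sum>a\<le>n. fps_const (t ^ (n - a)) * ?G n a * ?g (Suc a)))
      = (\<Sum>a\<le>Suc n. ?G n a * ?g a) + (\<Sum>a\<le>n. fps_const (t ^ (n - a)) * ?G n a * ?g (Suc a))"
      using t by (simp add: sum.atMost_Suc_shift[of "\<lambda>a. ?G n a * ?g a" n] add.assoc del: sum.atMost_Suc)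
    also have "(\<Sum>a\<le>Suc n. ?G n a * ?g a) = (\<Sum>a\<le>n. ?G n a * ?g a)"
      by (simp only: sum.atMost_Suc) (simp add: gauss_binom_def)
    also have "\<dots> = (1 - u) * ?L n z"
      unfolding sum_distrib_left
      by (intro sum.cong refl) (simp add: qtail_Suc u_def ac_simps flip: fps_const_mult)
    also have "(\<Sum>a\<le>n. fps_const (t ^ (n - a)) * ?G n a * ?g (Suc a)) = c * ?L n w"
      unfolding sum_distrib_left
    proof (intro sum.cong refl)
      fix a assume "a \<in> {..n}"
      \<comment> \<open>The exponent of \<open>t\<close> contains a surplus \<open>a\<close>, which
        is absorbed by passing from \<open>z ^ a\<close> to \<open>w ^ a\<close>.\<close>
      then have "n - a + Suc a * Suc a = Suc n + a * a + a" by simp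
      then have e: "t ^ (n - a) * t ^ (Suc a * Suc a) = t ^ Suc n * t ^ (a * a) * t ^ a"
        by (simp only: power_add[symmetric])
      have "fps_const (t ^ (n - a)) * ?G n a * ?g (Suc a) =
         fps_const (t ^ (n - a) * t ^ (Suc a * Suc a) * p ^ (Suc a * m) * gauss_binom t n a) * z ^ Suc a * qtail t w a n"
        by (simp add: qtail_shift w_def ac_simps flip: fps_const_mult)
      also have "\<dots> = c * (fps_const (gauss_binom t n a * t ^ (a * a) * p ^ (a * m)) * w ^ a * qtail t w a n)"
        unfolding e by (simp add: c_def w_def power_mult_distrib fps_const_power power_add ac_simps flip: fps_const_mult)
      finally show "fps_const (t ^ (n - a)) * ?G n a * ?g (Suc a) =
        c * (fps_const (gauss_binom t n a * t ^ (a * a) * p ^ (a * m)) * w ^ a * qtail t w a n)" .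
    qed
    finally show ?thesis .
  qed
  also have "\<dots> = (1 - u) * ?R n z + c * ?R n w"
    by (simp only: Suc.IH)
  also have "\<dots> = ?R (Suc n) z"
  proof -
    define e where "e b = gauss_binom t m b * t ^ (b * b) * p ^ (b * m)" for b
    have R: "?R k y = (\<Sum>b\<le>m. fps_const (e b * qfall t k b) * y ^ b)" for k y by (simp add: e_def)
    \<comment> \<open>This is the recursion of the right side at the coefficient of
      \<open>z ^ Suc b\<close>. The increment of \<open>qfall\<close> contains
      \<open>1 - t ^ Suc b\<close>, which trades the binomial at \<open>Suc b\<close> for the one at
      \<open>b\<close> times \<open>1 - t^(m-b)\<close>; then \<open>p^m t^b = p^(m-b)\<close> gives
      the final difference.\<close>
    have step: "e (Suc b) * (qfall t (Suc n) (Suc b) - qfall t n (Suc b)) =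
       e b * qfall t n b * (t ^ Suc n * p ^ m * t ^ b - t ^ Suc n)" if "b \<le> m" for b
    proof (cases "b \<le> n")
      case True
      have g: "gauss_binom t m (Suc b) * (1 - t ^ Suc b) = gauss_binom t m b * (1 - t ^ (m - b))"
        by (rule gauss_binom_Suc_right[OF t])
      have pm: "p ^ m * t ^ b = p ^ (m - b)"
      proof -
        have "p ^ m * t ^ b = p ^ (m - b) * (p * t) ^ b"
          using that unfolding power_mult_distrib mult.assoc[symmetric] by (simp only: power_add[symmetric]) simp
        then show ?thesis using pt by simp
      qed
      have p1: "p ^ (m - b) * t ^ (m - b) = 1" using pt by (simp flip: power_mult_distrib)
      have q: "qfall t (Suc n) (Suc b) - qfall t n (Suc b) = qfall t n b * (t ^ (n - b) * (1 - t ^ Suc b))"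
      proof -
        have "n - b + Suc b = Suc n" using True by simp
        then have "t ^ Suc n = t ^ (n - b) * t ^ Suc b" by (simp only: power_add[symmetric])
        then show ?thesis by (simp only: qfall_Suc_Suc qfall_Suc[of t n b]) (simp only: algebra_simps)
      qed
      have "Suc b * Suc b + (n - b) = b * b + b + Suc n" using True by simp
      then have es: "t ^ (Suc b * Suc b) * t ^ (n - b) = t ^ (b * b) * t ^ b * t ^ Suc n"
        by (simp only: power_add[symmetric])
      have "e (Suc b) * (qfall t (Suc n) (Suc b) - qfall t n (Suc b)) =
         gauss_binom t m (Suc b) * (1 - t ^ Suc b) * (t ^ (Suc b * Suc b) * t ^ (n - b)) * p ^ (b * m) * p ^ m * qfall t n b"
        unfolding q e_def by (simp add: power_add ac_simps)
      also have "\<dots> = gauss_binom t m b * t ^ (b * b) * p ^ (b * m) * qfall t n b * t ^ Suc n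
          * ((p ^ m * t ^ b) * (1 - t ^ (m - b)))"
        unfolding g es by (simp add: ac_simps)
      also have "(p ^ m * t ^ b) * (1 - t ^ (m - b)) = p ^ m * t ^ b - 1"
        unfolding pm using p1 by (simp add: algebra_simps)
      finally show ?thesis by (simp add: e_def algebra_simps)
    next
      case False
      then show ?thesis by (simp add: qfall_eq_0)
    qed
    \<comment> \<open>The upper limit may be raised to \<open>Suc m\<close>, where the binomial is
      0. The term \<open>b = 0\<close> drops out because \<open>qfall\<close> is 1 there for both
      \<open>n\<close> and \<open>Suc n\<close>, which allows the index shift.\<close>
    have "?R (Suc n) z - ?R n z = (\<Sum>b\<le>Suc m. fps_const (e b * (qfall t (Suc n) b - qfall t n b)) * z ^ b)"
      unfolding R by (simp add: sum_subtractf algebra_simps e_def gauss_binom_def flip: fps_const_mult fps_const_sub)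
    also have "\<dots> = (\<Sum>b\<le>m. fps_const (e (Suc b) * (qfall t (Suc n) (Suc b) - qfall t n (Suc b))) * z ^ Suc b)"
      by (subst sum.atMost_Suc_shift) simp
    also have "\<dots> = (\<Sum>b\<le>m. fps_const (e b * qfall t n b * (t ^ Suc n * p ^ m * t ^ b - t ^ Suc n)) * z ^ Suc b)"
      using step by (intro sum.cong refl) simp
    also have "\<dots> = c * ?R n w - u * ?R n z"
      unfolding R sum_distrib_left sum_subtractf[symmetric] c_def u_def w_def
      by (intro sum.cong refl)
         (simp add: power_mult_distrib fps_const_power algebra_simps flip: fps_const_mult fps_const_sub)
    finally show ?thesis by (simp add: algebra_simps)
  qed
  finally show ?case .
qed

section \<open>From base t to base p\<close>

lemma qpoch_inverse:
  assumes "p * t = (1::real)"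
  shows "qpoch p k = (\<Prod>j=1..k. - (p ^ j)) * qpoch t k"
proof -
  have "(1 - p ^ j) = - (p ^ j) * (1 - t ^ j)" for j
  proof -
    have "p ^ j * t ^ j = 1" using assms by (simp flip: power_mult_distrib)
    then show ?thesis by (simp add: algebra_simps)
  qed
  then show ?thesis by (simp add: qpoch_def flip: prod.distrib)
qed

text \<open>In the quotient of the three q-factorials the signs cancel and the powers of
  \<open>p\<close> from \<open>qpoch_inverse\<close> collect to \<open>p^(b(m-b))\<close>. The
  coefficients \<open>Ccoeff\<close> use base \<open>p\<close>, the automorphism counts base
  \<open>t\<close>.\<close>

lemma qbinom_inverse:
  assumes p: "p > 1" and pt: "p * t = (1::real)" and b: "b \<le> m"
  shows "qbinom p m (m - b) = p ^ (b * (m - b)) * gauss_binom t m b"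
proof -
  define s where "s k = (\<Prod>j=1..k. - (p ^ j))" for k
  have nz: "s k \<noteq> 0" for k using p by (auto simp: s_def)
  have "s (d + b) = s b * s d * p ^ (b * d)" for d
  proof (induction d)
    case (Suc d)
    have "s (Suc d + b) = s (d + b) * - (p ^ Suc (d + b))" by (simp add: s_def)
    moreover have "s (Suc d) = s d * - (p ^ Suc d)" by (simp add: s_def)
    ultimately show ?case using Suc by (simp add: power_add algebra_simps)
  qed (simp add: s_def)
  from this[of "m - b"] have sm: "s m = s b * s (m - b) * p ^ (b * (m - b))" using b by simp
  have q: "qpoch p k = s k * qpoch t k" for k unfolding s_def by (rule qpoch_inverse[OF pt])
  show ?thesis using b nz
    by (simp add: qbinom_def gauss_binom_def q sm field_simps)
qed

text \<open>This is \<open>gauss_identity\<close> with \<open>n\<close>, \<open>m\<close>,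
  \<open>a\<close>, \<open>b\<close> lowered by \<open>c\<close> and \<open>z\<close> scaled by
  \<open>t^c\<close>, multiplied by the common factor \<open>K\<close>. In
  \<open>sub_series_rec\<close>, \<open>c\<close> is the length of the first column of
  \<open>nu\<close>, \<open>m\<close> that of \<open>lam\<close>, and \<open>b\<close> runs over the
  lengths of a column put in front of \<open>nu\<close>.\<close>

lemma gauss_identity_shifted:
  assumes p: "p > 1" and pt: "p * t = (1::real)" and cm: "c \<le> m"
  shows "(\<Sum>a=c..n. fps_const (t ^ (a * a) * p ^ (m * a) / (qpoch t (n - a) * qpoch t (a - c))) * z ^ a * qtail t z a n) =
    (\<Sum>b=c..m. fps_const (if b \<le> n then p ^ (c * (m - b)) * qbinom p (m - c) (m - b) / qpoch t (n - b) else 0) * z ^ b)"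
proof (cases "c \<le> n")
  case False
  then show ?thesis by (auto intro!: sum.neutral[symmetric])
next
  case True
  have t: "0 < t" "t \<noteq> 1"
    using p pt by (auto simp: zero_less_mult_iff) (metis less_trans mult_pos_pos not_less_iff_gr_or_eq zero_less_one zero_less_mult_pos)
  obtain n' where n: "n = c + n'" using True le_Suc_ex by blast
  obtain m' where m: "m = c + m'" using cm le_Suc_ex by blast
  define w where "w = fps_const (t ^ c) * z"
  define K where "K = fps_const (p ^ (m' * c) / qpoch t n') * z ^ c"
  have nz: "qpoch t k \<noteq> 0" for k by (rule qpoch_nonzero[OF t])
  have shift: "(\<Sum>a=c..c + k. f a) = (\<Sum>a\<le>k. f (c + a))" for f :: "nat \<Rightarrow> real fps" and k
    using sum.shift_bounds_cl_nat_ivl[of f 0 c k] by (simp add: add.commute atLeast0AtMost)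
  have inv: "p ^ k * t ^ k = 1" for k using pt by (simp flip: power_mult_distrib)
  have "(\<Sum>a=c..n. fps_const (t ^ (a * a) * p ^ (m * a) / (qpoch t (n - a) * qpoch t (a - c))) * z ^ a * qtail t z a n)
    = K * (\<Sum>a\<le>n'. fps_const (gauss_binom t n' a * t ^ (a * a) * p ^ (a * m')) * w ^ a * qtail t w a n')"
    unfolding n shift sum_distrib_left
  proof (intro sum.cong refl)
    fix a assume a: "a \<in> {..n'}"
    have "t ^ ((c + a) * (c + a)) * p ^ (m * (c + a)) =
      (p ^ (c * c) * t ^ (c * c)) * (p ^ (c * a) * t ^ (c * a)) * (t ^ (c * a) * t ^ (a * a) * p ^ (a * m') * p ^ (m' * c))"
      unfolding m by (simp only: algebra_simps power_add)
    also have "\<dots> = t ^ (c * a) * t ^ (a * a) * p ^ (a * m') * p ^ (m' * c)" unfolding inv by simp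
    finally have e: "t ^ ((c + a) * (c + a)) * p ^ (m * (c + a)) / (qpoch t (c + n' - (c + a)) * qpoch t (c + a - c))
      = (p ^ (m' * c) / qpoch t n') * (gauss_binom t n' a * t ^ (a * a) * p ^ (a * m')) * (t ^ c) ^ a"
      using a nz by (simp add: gauss_binom_def qbinom_def power_mult[symmetric] ac_simps)
    show "fps_const (t ^ ((c + a) * (c + a)) * p ^ (m * (c + a)) / (qpoch t (c + n' - (c + a)) * qpoch t (c + a - c)))
        * z ^ (c + a) * qtail t z (c + a) (c + n') =
      K * (fps_const (gauss_binom t n' a * t ^ (a * a) * p ^ (a * m')) * w ^ a * qtail t w a n')"
      unfolding e qtail_scale w_def[symmetric] K_def
      by (simp add: w_def power_mult_distrib fps_const_power power_add ac_simps flip: fps_const_mult)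
  qed
  also have "\<dots> = K * (\<Sum>b\<le>m'. fps_const (gauss_binom t m' b * t ^ (b * b) * p ^ (b * m') * qfall t n' b) * w ^ b)"
    by (simp only: gauss_identity[OF t pt])
  also have "\<dots> = (\<Sum>b=c..m. fps_const (if b \<le> n then p ^ (c * (m - b)) * qbinom p (m - c) (m - b) / qpoch t (n - b) else 0) * z ^ b)"
    unfolding m shift sum_distrib_left
  proof (intro sum.cong refl)
    fix b assume "b \<in> {..m'}"
    then obtain d where d: "m' = b + d" using le_Suc_ex by auto
    have "(p ^ (m' * c) / qpoch t n') * (gauss_binom t m' b * t ^ (b * b) * p ^ (b * m') * qfall t n' b) * (t ^ c) ^ b
      = (p ^ (c * b) * t ^ (c * b)) * (p ^ (b * b) * t ^ (b * b)) * (p ^ (c * d) * (p ^ (b * d) * gauss_binom t m' b) * (qfall t n' b / qpoch t n'))"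
      unfolding d by (simp add: algebra_simps power_add flip: power_mult)
    also have "\<dots> = p ^ (c * d) * qbinom p m' (m' - b) * (qfall t n' b / qpoch t n')"
      unfolding inv using qbinom_inverse[OF p pt, of b m'] d by simp
    also have "qfall t n' b / qpoch t n' = (if b \<le> n' then 1 / qpoch t (n' - b) else 0)"
      using nz qpoch_eq_qfall[of b n' t] by (auto simp: qfall_eq_0 field_simps)
    finally have "(p ^ (m' * c) / qpoch t n') * (gauss_binom t m' b * t ^ (b * b) * p ^ (b * m') * qfall t n' b) * (t ^ c) ^ b
      = (if c + b \<le> n then p ^ (c * (c + m' - (c + b))) * qbinom p (c + m' - c) (c + m' - (c + b)) / qpoch t (n - (c + b)) else 0)"
      using d by (auto simp: n)
    from this[symmetric] show "K * (fps_const (gauss_binom t m' b * t ^ (b * b) * p ^ (b * m') * qfall t n' b) * w ^ b)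
      = fps_const (if c + b \<le> n then p ^ (c * (c + m' - (c + b))) * qbinom p (c + m' - c) (c + m' - (c + b)) / qpoch t (n - (c + b)) else 0) * z ^ (c + b)"
      unfolding K_def by (simp only:) (simp add: w_def power_mult_distrib fps_const_power power_add ac_simps flip: fps_const_mult)
  qed
  finally show ?thesis .
qed

section \<open>Columns of a partition\<close>

text \<open>The new first column has length \<open>r\<close> only if \<open>size nu \<le> r\<close>;
  otherwise the truncated subtraction adds no parts.\<close>

definition add_column :: "nat \<Rightarrow> nat multiset \<Rightarrow> nat multiset" where
  "add_column r nu = image_mset Suc nu + replicate_mset (r - size nu) 1"

text \<open>Parts equal to 1 are dropped instead of becoming 0, so the result is always a
  partition.\<close>

definition remove_column :: "nat multiset \<Rightarrow> nat multiset" where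
  "remove_column mu = image_mset (\<lambda>k. k - 1) (filter_mset (\<lambda>k. 2 \<le> k) mu)"

lemma int_partition_add_column: "int_partition (add_column r nu)"
  by (auto simp: int_partition_def add_column_def)

lemma int_partition_remove_column: "int_partition (remove_column mu)"
  by (auto simp: int_partition_def remove_column_def)

lemma remove_column_add_column:
  assumes "int_partition nu"
  shows "remove_column (add_column r nu) = nu"
proof -
  have "remove_column (image_mset Suc nu) = nu"
    using assms by (induction nu) (auto simp: remove_column_def int_partition_def)
  moreover have "remove_column (replicate_mset n 1) = {#}" for n
    by (induction n) (auto simp: remove_column_def)
  ultimately show ?thesis by (simp add: add_column_def remove_column_def)
qed

lemma size_remove_column_le: "size (remove_column mu) \<le> size mu"
  by (simp add: remove_column_def size_filter_mset_lesseq)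

lemma add_column_remove_column:
  assumes "int_partition mu"
  shows "add_column (size mu) (remove_column mu) = mu"
  using assms
proof (induction mu)
  case empty
  then show ?case by (simp add: add_column_def remove_column_def)
next
  case (add x M)
  then have x: "x > 0" and IH: "add_column (size M) (remove_column M) = M"
    by (auto simp: int_partition_def)
  show ?case
  proof (cases "2 \<le> x")
    case True
    then have "remove_column (add_mset x M) = add_mset (x - 1) (remove_column M)"
      by (simp add: remove_column_def)
    then show ?thesis using IH True by (simp add: add_column_def)
  next
    case False
    then have "remove_column (add_mset x M) = remove_column M" by (simp add: remove_column_def)
    moreover have "x = 1" using False x by simp
    ultimately show ?thesis using IH size_remove_column_le[of M]
      by (simp add: add_column_def Suc_diff_le)
  qed
qed

lemma size_add_column: "size nu \<le> r \<Longrightarrow> size (add_column r nu) = r"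
  by (simp add: add_column_def)

lemma sum_mset_add_column_fun:
  "(\<Sum>x\<in>#add_column r nu. f x) = (\<Sum>x\<in>#nu. f (Suc x)) + of_nat (r - size nu) * (f 1 :: nat)"
  by (simp add: add_column_def image_mset.compositionality comp_def)

lemma sum_mset_add_column:
  assumes "size nu \<le> r"
  shows "sum_mset (add_column r nu) = r + sum_mset nu"
proof -
  have "(\<Sum>x\<in>#nu. Suc x) = size nu + sum_mset nu" by (induction nu) auto
  then show ?thesis using sum_mset_add_column_fun[of "\<lambda>x. x" r nu] assms by simp
qed

section \<open>Conjugate parts and containment of Young diagrams\<close>

lemma conj_part_union: "conj_part (M + N) i = conj_part M i + conj_part N i"
  by (simp add: conj_part_def)

lemma conj_part_add_column:
  assumes "size nu \<le> r"
  shows "conj_part (add_column r nu) (Suc i) = (if i = 0 then r else conj_part nu i)"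
proof -
  have "conj_part (image_mset Suc nu) (Suc i) = conj_part nu i"
    by (induction nu) (auto simp: conj_part_def)
  moreover have "conj_part (replicate_mset n 1) (Suc i) = (if i = 0 then n else 0)" for n
    by (induction n) (auto simp: conj_part_def)
  \<comment> \<open>At index 0 every part counts, so the shifted parts and the new ones together
    make \<open>r\<close>.\<close>
  moreover have "conj_part nu 0 = size nu" by (simp add: conj_part_def)
  ultimately show ?thesis using assms unfolding add_column_def conj_part_union by auto
qed

lemma conj_part_1: "int_partition nu \<Longrightarrow> conj_part nu (Suc 0) = size nu"
  by (induction nu) (auto simp: conj_part_def int_partition_def)

lemma conj_part_empty [simp]: "conj_part {#} i = 0"
  by (simp add: conj_part_def)

lemma nth_part_empty [simp]: "nth_part {#} i = 0"
  by (simp add: nth_part_def)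

text \<open>In a decreasing list the entries that are at least \<open>j\<close> form an initial
  segment.\<close>

lemma less_length_filter_ge_iff:
  fixes xs :: "'a::linorder list"
  assumes "sorted_wrt (\<ge>) xs"
  shows "i < length (filter (\<lambda>x. j \<le> x) xs) \<longleftrightarrow> i < length xs \<and> j \<le> xs ! i"
  using assms
proof (induction xs arbitrary: i)
  case (Cons x xs)
  show ?case
  proof (cases "j \<le> x")
    case True
    then show ?thesis using Cons by (cases i) auto
  next
    case False
    then have "filter (\<lambda>x. j \<le> x) xs = []"
      using Cons.prems by (auto simp: filter_empty_conv)
    moreover have "\<not> j \<le> (x # xs) ! i" if "i < length (x # xs)"
      using Cons.prems False that nth_mem[of i "x # xs"] by auto
    ultimately show ?thesis using False by auto
  qed
qed simp

text \<open>Both sides say that the cell in row \<open>i\<close>, counted from 0, and column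
  \<open>j\<close>, counted from 1, lies in the Young diagram.\<close>

lemma less_conj_part_iff:
  assumes "0 < j"
  shows "i < conj_part mu j \<longleftrightarrow> j \<le> nth_part mu i"
proof -
  define xs where "xs = rev (sorted_list_of_multiset mu)"
  have len: "length xs = size mu" unfolding xs_def by (metis length_rev mset_sorted_list_of_multiset size_mset)
  have "conj_part mu j = size (filter_mset (\<lambda>x. j \<le> x) (mset xs))"
    by (simp add: conj_part_def xs_def)
  also have "\<dots> = length (filter (\<lambda>x. j \<le> x) xs)" by (simp flip: mset_filter)
  finally have c: "conj_part mu j = length (filter (\<lambda>x. j \<le> x) xs)" .
  have "sorted_wrt (\<ge>) xs"
    unfolding xs_def sorted_wrt_rev by (simp add: sorted_sorted_list_of_multiset)
  from less_length_filter_ge_iff[OF this, of i j] show ?thesis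
    using assms len unfolding c by (auto simp: nth_part_def xs_def)
qed

text \<open>Containment of diagrams can be tested by rows or by columns: by
  \<open>less_conj_part_iff\<close>, a row or column that is too long exhibits a cell of
  \<open>nu\<close> outside \<open>lam\<close>.\<close>

lemma part_le_iff_conj_part: "part_le nu lam \<longleftrightarrow> (\<forall>j>0. conj_part nu j \<le> conj_part lam j)"
proof
  assume le: "part_le nu lam"
  show "\<forall>j>0. conj_part nu j \<le> conj_part lam j"
  proof (intro allI impI, rule ccontr)
    fix j :: nat assume j: "0 < j" "\<not> conj_part nu j \<le> conj_part lam j"
    then have "j \<le> nth_part nu (conj_part lam j)" by (simp flip: less_conj_part_iff)
    also have "\<dots> \<le> nth_part lam (conj_part lam j)" using le by (simp add: part_le_def)
    finally have "conj_part lam j < conj_part lam j" using j less_conj_part_iff by blast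
    then show False by simp
  qed
next
  assume le: "\<forall>j>0. conj_part nu j \<le> conj_part lam j"
  show "part_le nu lam" unfolding part_le_def
  proof
    fix i show "nth_part nu i \<le> nth_part lam i"
    proof (cases "nth_part nu i = 0")
      case False
      then have pos: "0 < nth_part nu i" by simp
      then have "i < conj_part nu (nth_part nu i)" by (simp add: less_conj_part_iff)
      also have "\<dots> \<le> conj_part lam (nth_part nu i)" using le pos by blast
      finally show ?thesis using pos by (simp add: less_conj_part_iff)
    qed simp
  qed
qed

lemma nth_part_add_column:
  assumes "size nu \<le> r"
  shows "nth_part (add_column r nu) i = (if i < r then Suc (nth_part nu i) else 0)"
proof -
  let ?k = "if i < r then Suc (nth_part nu i) else 0"
  \<comment> \<open>Two natural numbers with the same lower bounds are equal, and the positive lower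
    bounds of a part are read off from the columns.\<close>
  have eq: "j \<le> nth_part (add_column r nu) i \<longleftrightarrow> j \<le> ?k" for j
  proof (cases j)
    case (Suc j')
    have le: "conj_part nu j' \<le> r" using assms size_filter_mset_lesseq[of _ nu] unfolding conj_part_def by (rule order_trans[rotated])
    have "j \<le> nth_part (add_column r nu) i \<longleftrightarrow> i < (if j' = 0 then r else conj_part nu j')"
      using Suc less_conj_part_iff[of j i "add_column r nu"] conj_part_add_column[OF assms, of j'] by simp
    also have "\<dots> \<longleftrightarrow> j \<le> ?k"
      using le less_conj_part_iff[of j' i nu] Suc by (cases "j' = 0") auto
    finally show ?thesis .
  qed simp
  from iffD1[OF eq order.refl] iffD2[OF eq order.refl] show ?thesis by (rule order_antisym)
qed

lemma nth_part_pos_iff: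
  assumes "int_partition nu"
  shows "0 < nth_part nu i \<longleftrightarrow> i < size nu"
  using less_conj_part_iff[of 1 i nu] conj_part_1[OF assms] by (simp add: Suc_le_eq)

lemma conj_part_remove_column:
  assumes "int_partition lam" "0 < i"
  shows "conj_part (remove_column lam) i = conj_part lam (Suc i)"
  using conj_part_add_column[OF size_remove_column_le, of lam i] add_column_remove_column[OF assms(1)] assms(2)
  by simp

text \<open>Compared by columns: the first ones give \<open>b \<le> size lam\<close>, and the others
  are the columns of \<open>nu\<close> and of \<open>remove_column lam\<close>.\<close>

lemma part_le_add_column_iff:
  assumes lam: "int_partition lam" and nu: "size nu \<le> b"
  shows "part_le (add_column b nu) lam \<longleftrightarrow> b \<le> size lam \<and> part_le nu (remove_column lam)"
proof -
  have shift: "(\<forall>j>0. P j) \<longleftrightarrow> (\<forall>i. P (Suc i))" for P :: "nat \<Rightarrow> bool"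
    by (metis gr0_conv_Suc)
  have split: "(\<forall>i. (if i = 0 then b else c i) \<le> d i) \<longleftrightarrow> b \<le> d 0 \<and> (\<forall>i>0. c i \<le> d i)"
    for c d :: "nat \<Rightarrow> nat" by (metis gr0I less_irrefl)
  have "part_le (add_column b nu) lam \<longleftrightarrow>
      (\<forall>i. (if i = 0 then b else conj_part nu i) \<le> conj_part lam (Suc i))"
    unfolding part_le_iff_conj_part shift conj_part_add_column[OF nu] by (rule refl)
  also have "\<dots> \<longleftrightarrow> b \<le> size lam \<and> (\<forall>i>0. conj_part nu i \<le> conj_part lam (Suc i))"
    unfolding split conj_part_1[OF lam] by (rule refl)
  finally show ?thesis
    by (simp add: part_le_iff_conj_part conj_part_remove_column[OF lam])
qed

lemma part_le_size:
  assumes "int_partition nu" "int_partition lam" "part_le nu lam"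
  shows "size nu \<le> size lam"
  using assms by (metis conj_part_1 part_le_iff_conj_part zero_less_Suc)

lemma finite_partitions_sum: "finite {mu. int_partition mu \<and> sum_mset mu = n}"
proof (rule finite_subset)
  show "finite (\<Union>k\<le>n. {mu. set_mset mu \<subseteq> {..n} \<and> size mu = k})"
    using finite_multisets_of_size[of "{..n}"] by (auto simp: multisets_of_size_def)
  have "size mu \<le> sum_mset mu" if "int_partition mu" for mu
    using that by (induction mu) (auto simp: int_partition_def)
  moreover have "x \<le> sum_mset mu" if "x \<in># mu" for x and mu :: "nat multiset"
    using that by (auto dest!: multi_member_split)
  ultimately show "{mu. int_partition mu \<and> sum_mset mu = n}
      \<subseteq> (\<Union>k\<le>n. {mu. set_mset mu \<subseteq> {..n} \<and> size mu = k})" by auto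
qed

section \<open>Recursions for the weights\<close>

text \<open>The exponent of \<open>p\<close> in the order of the \<open>p^k\<close>-torsion of
  \<open>pgroup p mu\<close>; equivalently, the sum of the first \<open>k\<close> conjugate
  parts.\<close>

definition min_sum :: "nat multiset \<Rightarrow> nat \<Rightarrow> nat" where
  "min_sum mu k = (\<Sum>x\<in>#mu. min k x)"

lemma min_sum_0 [simp]: "min_sum mu 0 = 0"
  by (induction mu) (auto simp: min_sum_def)

lemma min_sum_Suc: "min_sum mu (Suc k) = min_sum mu k + conj_part mu (Suc k)"
  by (induction mu) (auto simp: min_sum_def conj_part_def)

lemma min_sum_add_column:
  assumes "size nu \<le> r"
  shows "min_sum (add_column r nu) (Suc k) = r + min_sum nu k"
proof -
  have "(\<Sum>x\<in>#nu. min (Suc k) (Suc x)) = size nu + (\<Sum>x\<in>#nu. min k x)" by (induction nu) auto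
  then show ?thesis using assms unfolding min_sum_def sum_mset_add_column_fun by simp
qed

lemma torsion_monomial_pgroup:
  assumes "p > 0"
  shows "torsion_monomial p lam (pgroup p mu) = p ^ (\<Sum>i\<in>#lam. min_sum mu i)"
proof -
  have "torsion_monomial p lam (pgroup p mu) = (\<Prod>i\<in>#lam. p ^ min_sum mu i)"
    by (simp add: torsion_monomial_def card_torsion_pgroup[OF assms] min_sum_def image_prod_mset_multiplicity)
  also have "\<dots> = p ^ (\<Sum>i\<in>#lam. min_sum mu i)"
    by (induction lam) (simp_all add: power_add)
  finally show ?thesis .
qed

text \<open>By \<open>min_sum_add_column\<close> the new column contributes \<open>p^r\<close> for
  each of the \<open>size lam\<close> parts. A part 1 of \<open>lam\<close> contributes nothing
  else, so it may disappear from \<open>lam\<close>.\<close>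

lemma torsion_monomial_add_column:
  assumes "p > 0" "int_partition lam" "size nu \<le> r"
  shows "torsion_monomial p lam (pgroup p (add_column r nu)) =
    p ^ (size lam * r) * torsion_monomial p (remove_column lam) (pgroup p nu)"
proof -
  define lam' where "lam' = remove_column lam"
  have "(\<Sum>i\<in>#add_column (size lam) lam'. min_sum (add_column r nu) i) =
     (\<Sum>i\<in>#lam'. r + min_sum nu i) + (size lam - size lam') * r"
    using assms(3) by (simp only: sum_mset_add_column_fun min_sum_add_column One_nat_def) simp
  also have "(\<Sum>i\<in>#lam'. r + min_sum nu i) = size lam' * r + (\<Sum>i\<in>#lam'. min_sum nu i)"
    by (induction lam') auto
  also have "\<dots> + (size lam - size lam') * r = (\<Sum>i\<in>#lam'. min_sum nu i) + (size lam' + (size lam - size lam')) * r"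
    by (simp only: distrib_left distrib_right ac_simps)
  also have "size lam' + (size lam - size lam') = size lam"
    using size_remove_column_le[of lam] by (simp add: lam'_def)
  finally show ?thesis
    unfolding torsion_monomial_pgroup[OF assms(1)] lam'_def add_column_remove_column[OF assms(2)]
    by (simp add: power_add)
qed

text \<open>The subtractions of natural numbers do not truncate: if part number \<open>j\<close> is
  \<open>k + 1\<close>, then more than \<open>j\<close> parts are at least \<open>k + 1\<close>, so
  \<open>min_sum\<close> grows by more than \<open>j\<close> from \<open>k\<close> to
  \<open>k + 1\<close>.\<close>

lemma card_auto_pgroup_real:
  assumes p: "prime p" and mu: "int_partition mu"
  shows "real (card (auto (pgroup p mu))) =
    (\<Prod>j<size mu. real p ^ min_sum mu (nth_part mu j) - real p ^ j * real p ^ min_sum mu (nth_part mu j - 1))"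
proof -
  have p1: "p \<ge> 1" using prime_gt_0_nat[OF p] by simp
  have "p ^ j * p ^ min_sum mu (nth_part mu j - 1) \<le> p ^ min_sum mu (nth_part mu j)" if "j < size mu" for j
  proof -
    have "0 < nth_part mu j" using that nth_part_pos_iff[OF mu] by simp
    then obtain k where k: "nth_part mu j = Suc k" using gr0_implies_Suc by blast
    then have "j < conj_part mu (Suc k)" by (simp add: less_conj_part_iff)
    then have "j + min_sum mu k \<le> min_sum mu (Suc k)" by (simp add: min_sum_Suc)
    then show ?thesis unfolding k using p1 by (simp add: power_increasing flip: power_add)
  qed
  then show ?thesis
    unfolding card_auto_pgroup[OF p mu] min_sum_def[symmetric]
    by (simp add: of_nat_diff)
qed

text \<open>In a factor with \<open>j < size nu\<close> both exponents increase by \<open>r\<close>.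
  The later parts are equal to 1, and their factors \<open>p^r - p^j = p^r (1 - (1/p)^(r-j))\<close>
  produce the q-factorial.\<close>

lemma card_auto_pgroup_add_column:
  assumes p: "prime p" and nu: "int_partition nu" and le: "size nu \<le> r"
  shows "real (card (auto (pgroup p (add_column r nu)))) =
    real p ^ (r * r) * qpoch (1 / real p) (r - size nu) * real (card (auto (pgroup p nu)))"
proof -
  let ?mu = "add_column r nu" and ?p = "real p"
  let ?F = "\<lambda>mu j. ?p ^ min_sum mu (nth_part mu j) - ?p ^ j * ?p ^ min_sum mu (nth_part mu j - 1)"
  have p0: "?p > 0" using prime_gt_0_nat[OF p] by simp
  have "real (card (auto (pgroup p ?mu))) = (\<Prod>j<r. ?F ?mu j)"
    using card_auto_pgroup_real[OF p int_partition_add_column, of r nu] size_add_column[OF le] by simp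
  also have "{..<r} = {..<size nu} \<union> {size nu..<r}" using le by auto
  also have "(\<Prod>j\<in>\<dots>. ?F ?mu j) = (\<Prod>j<size nu. ?F ?mu j) * (\<Prod>j=size nu..<r. ?F ?mu j)"
    by (rule prod.union_disjoint) auto
  also have "(\<Prod>j<size nu. ?F ?mu j) = (\<Prod>j<size nu. ?p ^ r * ?F nu j)"
  proof (intro prod.cong refl)
    fix j assume j: "j \<in> {..<size nu}"
    then have "0 < nth_part nu j" using nth_part_pos_iff[OF nu] by simp
    then obtain k where k: "nth_part nu j = Suc k" using gr0_implies_Suc by blast
    have mk: "nth_part ?mu j = Suc (Suc k)" using j le nth_part_add_column[OF le, of j] k by simp
    show "?F ?mu j = ?p ^ r * ?F nu j"
      unfolding mk k diff_Suc_1 min_sum_add_column[OF le] by (simp add: power_add algebra_simps)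
  qed
  also have "\<dots> = ?p ^ (r * size nu) * real (card (auto (pgroup p nu)))"
    unfolding card_auto_pgroup_real[OF p nu] by (simp add: prod.distrib power_mult)
  also have "(\<Prod>j=size nu..<r. ?F ?mu j) = (\<Prod>j=size nu..<r. ?p ^ r * (1 - (1 / ?p) ^ (r - j)))"
  proof (intro prod.cong refl)
    fix j assume j: "j \<in> {size nu..<r}"
    then have "\<not> 0 < nth_part nu j" using nth_part_pos_iff[OF nu] by simp
    then have mk: "nth_part ?mu j = Suc 0" using j nth_part_add_column[OF le, of j] by simp
    have "?p ^ r = ?p ^ j * ?p ^ (r - j)" using j by (simp flip: power_add)
    then have "?p ^ r * (1 / ?p) ^ (r - j) = ?p ^ j" using p0 by (simp add: power_one_over)
    then show "?F ?mu j = ?p ^ r * (1 - (1 / ?p) ^ (r - j))"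
      unfolding mk diff_Suc_1 min_sum_add_column[OF le] by (simp add: right_diff_distrib)
  qed
  also have "\<dots> = ?p ^ (r * (r - size nu)) * (\<Prod>j=size nu..<r. 1 - (1 / ?p) ^ (r - j))"
    by (simp add: prod.distrib power_mult)
  also have "(\<Prod>j=size nu..<r. 1 - (1 / ?p) ^ (r - j)) = qpoch (1 / ?p) (r - size nu)"
    unfolding qpoch_def
    by (rule prod.reindex_bij_witness[where i = "\<lambda>i. r - i" and j = "\<lambda>j. r - j"]) (use le in auto)
  finally have "real (card (auto (pgroup p ?mu))) = ?p ^ (r * size nu) * real (card (auto (pgroup p nu))) *
    (?p ^ (r * (r - size nu)) * qpoch (1 / ?p) (r - size nu))" .
  moreover have "?p ^ (r * r) = ?p ^ (r * size nu) * ?p ^ (r * (r - size nu))"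
    using le by (simp flip: power_add add_mult_distrib2)
  ultimately show ?thesis by simp
qed

lemma sum_atLeast1_Suc_shift:
  "(\<Sum>i=1..Suc n. f i) = f 1 + (\<Sum>i=1..n. (f (Suc i) :: 'a::comm_monoid_add))"
  by (induction n) (simp_all add: ac_simps)

lemma prod_atLeast1_Suc_shift:
  "(\<Prod>i=1..Suc n. f i) = f 1 * (\<Prod>i=1..n. (f (Suc i) :: 'a::comm_monoid_mult))"
  by (induction n) (simp_all add: ac_simps)

text \<open>The index 1 is split off from the sum and from the product, and the other indices are
  shifted by one.\<close>

lemma Ccoeff_add_column:
  assumes lam: "int_partition lam" and nu: "int_partition nu" and le: "size nu \<le> b" "b \<le> size lam"
  shows "Ccoeff lam (add_column b nu) q =
    q ^ (size nu * (size lam - b)) * qbinom q (size lam - size nu) (size lam - b) *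
    Ccoeff (remove_column lam) nu q"
\<comment> \<open>For empty \<open>lam\<close> there is no index 1 to split off, but then
  \<open>b = 0\<close> and the additional factors are 1.\<close>
proof (cases "lam = {#}")
  case True
  then show ?thesis using le by (simp add: Ccoeff_def remove_column_def qbinom_def qpoch_def)
next
  case False
  define lam' where "lam' = remove_column lam"
  define N where "N = nth_part lam' 0"
  have sz: "size lam' \<le> size lam" by (simp add: lam'_def size_remove_column_le)
  have lam_eq: "lam = add_column (size lam) lam'" by (simp add: lam'_def add_column_remove_column[OF lam])
  have "size lam > 0" using False by (simp add: nonempty_has_size)
  then have N: "nth_part lam 0 = Suc N" using nth_part_add_column[OF sz, of 0] by (simp add: N_def flip: lam_eq)
  have cl: "conj_part lam (Suc i) = (if i = 0 then size lam else conj_part lam' i)" for i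
    using conj_part_add_column[OF sz, of i] by (simp flip: lam_eq)
  have cn: "conj_part (add_column b nu) (Suc i) = (if i = 0 then b else conj_part nu i)" for i
    using conj_part_add_column[OF le(1)] .
  have c1: "conj_part nu (Suc 0) = size nu" by (rule conj_part_1[OF nu])
  let ?g = "\<lambda>i. conj_part (add_column b nu) (i + 1) * (conj_part lam i - conj_part (add_column b nu) i)"
  let ?h = "\<lambda>i. qbinom q (conj_part lam i - conj_part (add_column b nu) (i + 1)) (conj_part lam i - conj_part (add_column b nu) i)"
  have "(\<Sum>i=1..Suc N. ?g i) = ?g 1 + (\<Sum>i=1..N. ?g (Suc i))"
    by (rule sum_atLeast1_Suc_shift)
  also have "(\<Sum>i=1..N. ?g (Suc i)) = (\<Sum>i=1..N. conj_part nu (i + 1) * (conj_part lam' i - conj_part nu i))"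
    by (intro sum.cong refl) (simp add: cl cn)
  also have "?g 1 = size nu * (size lam - b)" by (simp add: cl cn c1)
  finally have 1: "(\<Sum>i=1..Suc N. ?g i) = size nu * (size lam - b) +
    (\<Sum>i=1..N. conj_part nu (i + 1) * (conj_part lam' i - conj_part nu i))" .
  have "(\<Prod>i=1..Suc N. ?h i) = ?h 1 * (\<Prod>i=1..N. ?h (Suc i))"
    by (rule prod_atLeast1_Suc_shift)
  also have "(\<Prod>i=1..N. ?h (Suc i)) =
      (\<Prod>i=1..N. qbinom q (conj_part lam' i - conj_part nu (i + 1)) (conj_part lam' i - conj_part nu i))"
    by (intro prod.cong refl) (simp add: cl cn)
  also have "?h 1 = qbinom q (size lam - size nu) (size lam - b)" by (simp add: cl cn c1)
  finally have 2: "(\<Prod>i=1..Suc N. ?h i) = qbinom q (size lam - size nu) (size lam - b) *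
      (\<Prod>i=1..N. qbinom q (conj_part lam' i - conj_part nu (i + 1)) (conj_part lam' i - conj_part nu i))" .
  show ?thesis
    unfolding Ccoeff_def N 1 2 lam'_def[symmetric] N_def[symmetric] by (simp add: power_add)
qed

lemma Ccoeff_empty:
  assumes "q > 1"
  shows "Ccoeff lam {#} q = 1"
  using assms by (simp add: Ccoeff_def qbinom_def qpoch_nonzero)

text \<open>The torsion monomial times the Cohen-Lenstra weight \<open>1/|Aut|\<close>.\<close>

definition cl_weight :: "nat \<Rightarrow> nat multiset \<Rightarrow> nat multiset \<Rightarrow> real" where
  "cl_weight p lam mu = real (torsion_monomial p lam (pgroup p mu)) / real (card (auto (pgroup p mu)))"

lemma cl_weight_empty:
  assumes "prime p"
  shows "cl_weight p lam {#} = 1"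
proof -
  have "int_partition {#}" by (simp add: int_partition_def)
  from card_auto_pgroup_real[OF assms this] have "real (card (auto (pgroup p {#}))) = 1" by simp
  moreover have "(\<Sum>i\<in>#lam. min_sum {#} i) = 0" by (induction lam) (simp_all add: min_sum_def)
  ultimately show ?thesis
    unfolding cl_weight_def torsion_monomial_pgroup[OF prime_gt_0_nat[OF assms]] by (simp only:) simp
qed

lemma cl_weight_add_column:
  assumes p: "prime p" and lam: "int_partition lam" and nu: "int_partition nu" and le: "size nu \<le> r"
  shows "cl_weight p lam (add_column r nu) =
    (1 / real p) ^ (r * r) * real p ^ (size lam * r) / qpoch (1 / real p) (r - size nu) *
    cl_weight p (remove_column lam) nu"
  using prime_gt_0_nat[OF p]
  by (simp add: cl_weight_def torsion_monomial_add_column[OF _ lam le] card_auto_pgroup_add_column[OF p nu le]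
      power_one_over field_simps)

section \<open>The generating series\<close>

text \<open>The usual convention that \<open>1/(t)_m\<close> is 0 for negative \<open>m\<close>; it
  removes all partitions with more than \<open>n\<close> parts.\<close>

definition qrecip :: "real \<Rightarrow> nat \<Rightarrow> nat \<Rightarrow> real" where
  "qrecip t n k = (if k \<le> n then 1 / qpoch t (n - k) else 0)"

lemma qpoch_mult_qrecip:
  assumes "0 < t" "t \<noteq> 1"
  shows "qpoch t n * qrecip t n k = qfall t n k"
  using qpoch_eq_qfall[of k n t] qpoch_nonzero[OF assms, of "n - k"]
  by (auto simp: qrecip_def qfall_eq_0 field_simps)

lemma qfall_tendsto:
  assumes "0 < t" "t < 1"
  shows "(\<lambda>n. qfall t n k) \<longlonglongrightarrow> 1"
proof -
  have "(\<lambda>n. t ^ (n - i)) \<longlonglongrightarrow> 0" for i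
    by (rule LIMSEQ_offset[of _ i]) (use LIMSEQ_power_zero[of t] assms in simp)
  then have "(\<lambda>n. \<Prod>i<k. 1 - t ^ (n - i)) \<longlonglongrightarrow> (\<Prod>i<k. 1 - 0)"
    by (intro tendsto_prod tendsto_diff tendsto_const)
  then show ?thesis by (simp add: qfall_def)
qed

definition partitions_of :: "nat \<Rightarrow> nat multiset set" where
  "partitions_of N = {mu. int_partition mu \<and> sum_mset mu = N}"

definition subpartitions :: "nat multiset \<Rightarrow> nat multiset set" where
  "subpartitions lam = {nu. int_partition nu \<and> part_le nu lam}"

lemma finite_partitions_of [simp]: "finite (partitions_of N)"
  unfolding partitions_of_def by (rule finite_partitions_sum)

lemma finite_subpartitions [simp]: "finite (subpartitions lam)"
  unfolding subpartitions_def by (rule finite_part_le)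

context
  fixes p :: nat and t :: real
  assumes p: "prime p" and t_def: "t = 1 / real p"
begin

lemma t_bounds: "0 < t" "t < 1" "t \<noteq> 1" "real p * t = 1" "real p > 1"
  using prime_gt_1_nat[OF p] by (auto simp: t_def)

text \<open>Defined by coefficients because, for \<open>n > 0\<close>, infinitely many
  \<open>mu\<close> have at most \<open>n\<close> parts, while each degree involves only finitely
  many.\<close>

definition moment_series :: "nat multiset \<Rightarrow> nat \<Rightarrow> real fps" where
  "moment_series lam n = Abs_fps (\<lambda>N. \<Sum>mu\<in>partitions_of N. cl_weight p lam mu * qrecip t n (size mu))"

definition sub_series :: "nat multiset \<Rightarrow> nat \<Rightarrow> real fps" where
  "sub_series lam n = (\<Sum>nu\<in>subpartitions lam.
     fps_const (Ccoeff lam nu (real p) * qrecip t n (size nu)) * fps_X ^ sum_mset nu)"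

text \<open>The factor that belongs to the index \<open>a\<close> in both recursions. Its
  denominator comes from \<open>qrecip t n a\<close>.\<close>

definition column_coeff :: "nat multiset \<Rightarrow> nat \<Rightarrow> nat \<Rightarrow> real" where
  "column_coeff lam n a = t ^ (a * a) * real p ^ (size lam * a) / qpoch t (n - a)"

section \<open>Recursions for the two generating series\<close>

lemma partitions_of_fixed_size:
  assumes "a \<le> N"
  shows "bij_betw (add_column a) {nu \<in> partitions_of (N - a). size nu \<le> a} {mu \<in> partitions_of N. size mu = a}"
proof (rule bij_betwI[where g = remove_column], goal_cases)
  case 1
  show ?case using assms
    by (auto simp: partitions_of_def int_partition_add_column sum_mset_add_column size_add_column)
next
  case 2
  show ?case
  proof
    fix mu assume "mu \<in> {mu \<in> partitions_of N. size mu = a}"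
    then have mu: "int_partition mu" "sum_mset mu = N" "size mu = a" by (auto simp: partitions_of_def)
    have le: "size (remove_column mu) \<le> a" using size_remove_column_le[of mu] mu by simp
    have "N = a + sum_mset (remove_column mu)"
      using sum_mset_add_column[OF le] add_column_remove_column[OF mu(1)] mu by simp
    then show "remove_column mu \<in> {nu \<in> partitions_of (N - a). size nu \<le> a}"
      using le by (simp add: partitions_of_def int_partition_remove_column)
  qed
next
  case (3 nu)
  then show ?case by (simp add: partitions_of_def remove_column_add_column)
next
  case (4 mu)
  then show ?case using add_column_remove_column[of mu] by (auto simp: partitions_of_def)
qed

text \<open>The partitions are grouped by their number \<open>a\<close> of parts, and the first
  column is removed. The denominator \<open>(t)_(a - size nu)\<close> from the automorphism count is
  exactly the \<open>qrecip t a (size nu)\<close> of the smaller series, so \<open>a\<close> becomes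
  its new bound.\<close>

lemma moment_series_rec:
  assumes lam: "int_partition lam"
  shows "moment_series lam n =
    (\<Sum>a\<le>n. fps_const (column_coeff lam n a) * (fps_X ^ a * moment_series (remove_column lam) a))"
proof (rule fps_ext)
  fix N
  define lam' where "lam' = remove_column lam"
  let ?w = "\<lambda>mu. cl_weight p lam mu * qrecip t n (size mu)"
  have "fps_nth (moment_series lam n) N = (\<Sum>mu\<in>{mu\<in>partitions_of N. size mu \<le> n}. ?w mu)"
    unfolding moment_series_def fps_nth_Abs_fps
    by (rule sum.mono_neutral_right) (auto simp: qrecip_def)
  also have "\<dots> = (\<Sum>a\<le>n. \<Sum>mu\<in>{mu\<in>{mu\<in>partitions_of N. size mu \<le> n}. size mu = a}. ?w mu)"
    by (rule sum.group[symmetric]) auto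
  also have "\<dots> = (\<Sum>a\<le>n. fps_nth (fps_const (column_coeff lam n a) * (fps_X ^ a * moment_series lam' a)) N)"
  proof (intro sum.cong refl)
    fix a assume a: "a \<in> {..n}"
    have eq: "{mu\<in>{mu\<in>partitions_of N. size mu \<le> n}. size mu = a} = {mu\<in>partitions_of N. size mu = a}"
      using a by auto
    show "(\<Sum>mu\<in>{mu\<in>{mu\<in>partitions_of N. size mu \<le> n}. size mu = a}. ?w mu) =
      fps_nth (fps_const (column_coeff lam n a) * (fps_X ^ a * moment_series lam' a)) N"
    proof (cases "a \<le> N")
      case False
      have "a \<le> N" if "mu \<in> partitions_of N" "size mu = a" for mu
        using that sum_mset_add_column[OF size_remove_column_le, of mu] add_column_remove_column[of mu]
        by (simp add: partitions_of_def)
      then have empty: "{mu\<in>partitions_of N. size mu = a} = {}" using False by blast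
      show ?thesis unfolding eq empty using False by (simp add: fps_X_power_mult_nth)
    next
      case True
      have "(\<Sum>mu\<in>{mu\<in>partitions_of N. size mu = a}. ?w mu) =
          (\<Sum>nu\<in>{nu \<in> partitions_of (N - a). size nu \<le> a}. ?w (add_column a nu))"
        by (rule sum.reindex_bij_betw[OF partitions_of_fixed_size[OF True], symmetric])
      also have "\<dots> = (\<Sum>nu\<in>{nu \<in> partitions_of (N - a). size nu \<le> a}.
          column_coeff lam n a * (cl_weight p lam' nu * qrecip t a (size nu)))"
      proof (intro sum.cong refl)
        fix nu assume "nu \<in> {nu \<in> partitions_of (N - a). size nu \<le> a}"
        then have nu: "int_partition nu" "size nu \<le> a" by (auto simp: partitions_of_def)
        show "?w (add_column a nu) = column_coeff lam n a * (cl_weight p lam' nu * qrecip t a (size nu))"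
          using a nu unfolding cl_weight_add_column[OF p lam nu] t_def[symmetric]
          by (simp add: size_add_column qrecip_def column_coeff_def lam'_def)
      qed
      also have "\<dots> = column_coeff lam n a * (\<Sum>nu\<in>partitions_of (N - a). cl_weight p lam' nu * qrecip t a (size nu))"
        unfolding sum_distrib_left by (rule sum.mono_neutral_left) (auto simp: qrecip_def)
      finally show ?thesis unfolding eq using True
        by (simp add: moment_series_def fps_X_power_mult_nth)
    qed
  qed
  finally show "fps_nth (moment_series lam n) N =
    fps_nth (\<Sum>a\<le>n. fps_const (column_coeff lam n a) * (fps_X ^ a * moment_series lam' a)) N"
    by (simp only: fps_sum_nth)
qed

lemma bij_betw_subpartitions:
  assumes lam: "int_partition lam"
  shows "bij_betw (\<lambda>(nu, b). add_column b nu)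
    (SIGMA nu:subpartitions (remove_column lam). {size nu..size lam}) (subpartitions lam)"
proof (rule bij_betwI[where g = "\<lambda>mu. (remove_column mu, size mu)"], goal_cases)
  case 1
  show ?case
    by (auto simp: subpartitions_def int_partition_add_column part_le_add_column_iff[OF lam])
next
  case 2
  show ?case
  proof
    fix mu assume "mu \<in> subpartitions lam"
    then have mu: "int_partition mu" "part_le mu lam" by (auto simp: subpartitions_def)
    have "part_le (add_column (size mu) (remove_column mu)) lam"
      using mu by (simp add: add_column_remove_column)
    then show "(remove_column mu, size mu) \<in> (SIGMA nu:subpartitions (remove_column lam). {size nu..size lam})"
      by (simp add: part_le_add_column_iff[OF lam size_remove_column_le] subpartitions_def
          int_partition_remove_column size_remove_column_le)
  qed
next
  case (3 x)
  then show ?case by (auto simp: subpartitions_def remove_column_add_column size_add_column)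
next
  case (4 mu)
  then show ?case by (simp add: subpartitions_def add_column_remove_column)
qed

text \<open>Every subpartition is some \<open>nu\<close> in \<open>remove_column lam\<close> with a
  column of length \<open>b\<close> in front. For fixed \<open>nu\<close> the sum over
  \<open>b\<close> is the right side of \<open>gauss_identity_shifted\<close>; its left side is a
  sum over \<open>a\<close> of the shape of \<open>moment_series_rec\<close>, and it remains to
  exchange the sums over \<open>nu\<close> and \<open>a\<close>.\<close>

lemma sub_series_rec:
  assumes lam: "int_partition lam"
  shows "sub_series lam n = (\<Sum>a\<le>n. fps_const (column_coeff lam n a) *
    (fps_X ^ a * (qtail t fps_X a n * sub_series (remove_column lam) a)))"
proof -
  define lam' where "lam' = remove_column lam"
  define C where "C nu = fps_const (Ccoeff lam' nu (real p)) * (fps_X :: real fps) ^ sum_mset nu" for nu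
  let ?l = "size lam"
  have le_l: "size nu \<le> ?l" if "nu \<in> subpartitions lam'" for nu
    using that part_le_size[of nu lam'] int_partition_remove_column[of lam] size_remove_column_le[of lam]
    by (auto simp: subpartitions_def lam'_def)
  have "sub_series lam n = (\<Sum>(nu, b)\<in>(SIGMA nu:subpartitions lam'. {size nu..?l}).
     fps_const (Ccoeff lam (add_column b nu) (real p) * qrecip t n (size (add_column b nu)))
       * fps_X ^ sum_mset (add_column b nu))"
    unfolding sub_series_def lam'_def
    by (subst sum.reindex_bij_betw[OF bij_betw_subpartitions[OF lam], symmetric]) (simp add: case_prod_unfold)
  also have "\<dots> = (\<Sum>nu\<in>subpartitions lam'. \<Sum>b=size nu..?l.
     fps_const (Ccoeff lam (add_column b nu) (real p) * qrecip t n (size (add_column b nu)))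
       * fps_X ^ sum_mset (add_column b nu))"
    by (rule sum.Sigma[symmetric]) auto
  also have "\<dots> = (\<Sum>nu\<in>subpartitions lam'. C nu * (\<Sum>b=size nu..?l.
     fps_const (if b \<le> n then real p ^ (size nu * (?l - b)) * qbinom (real p) (?l - size nu) (?l - b) / qpoch t (n - b) else 0) * fps_X ^ b))"
    unfolding sum_distrib_left
  proof (intro sum.cong refl)
    fix nu b assume nu: "nu \<in> subpartitions lam'" and b: "b \<in> {size nu..?l}"
    then have "int_partition nu" "size nu \<le> b" "b \<le> ?l" by (auto simp: subpartitions_def)
    note facts = Ccoeff_add_column[OF lam this] size_add_column[OF this(2)] sum_mset_add_column[OF this(2)]
    show "fps_const (Ccoeff lam (add_column b nu) (real p) * qrecip t n (size (add_column b nu))) * fps_X ^ sum_mset (add_column b nu)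
      = C nu * (fps_const (if b \<le> n then real p ^ (size nu * (?l - b)) * qbinom (real p) (?l - size nu) (?l - b) / qpoch t (n - b) else 0) * fps_X ^ b)"
      unfolding facts by (simp add: C_def lam'_def qrecip_def power_add ac_simps)
  qed
  also have "\<dots> = (\<Sum>nu\<in>subpartitions lam'. C nu * (\<Sum>a=size nu..n.
      fps_const (t ^ (a * a) * real p ^ (?l * a) / (qpoch t (n - a) * qpoch t (a - size nu))) * fps_X ^ a * qtail t fps_X a n))"
    using gauss_identity_shifted[OF t_bounds(5,4) le_l] by (intro sum.cong refl) simp
  also have "\<dots> = (\<Sum>nu\<in>subpartitions lam'. \<Sum>a\<le>n. fps_const (column_coeff lam n a) * (fps_X ^ a * (qtail t fps_X a n *
      (fps_const (Ccoeff lam' nu (real p) * qrecip t a (size nu)) * fps_X ^ sum_mset nu))))"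
  proof (intro sum.cong refl)
    fix nu
    have "(\<Sum>a\<le>n. fps_const (column_coeff lam n a) * (fps_X ^ a * (qtail t fps_X a n *
      (fps_const (Ccoeff lam' nu (real p) * qrecip t a (size nu)) * fps_X ^ sum_mset nu)))) =
      (\<Sum>a=size nu..n. fps_const (column_coeff lam n a) * (fps_X ^ a * (qtail t fps_X a n *
      (fps_const (Ccoeff lam' nu (real p) * qrecip t a (size nu)) * fps_X ^ sum_mset nu))))"
      \<comment> \<open>The terms with \<open>a < size nu\<close> are 0 by \<open>qrecip\<close>, so
        the range of \<open>a\<close> can be made independent of \<open>nu\<close>.\<close>
      by (rule sum.mono_neutral_right) (auto simp: qrecip_def)
    also have "\<dots> = C nu * (\<Sum>a=size nu..n.
      fps_const (t ^ (a * a) * real p ^ (?l * a) / (qpoch t (n - a) * qpoch t (a - size nu))) * fps_X ^ a * qtail t fps_X a n)"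
      unfolding sum_distrib_left
    proof (intro sum.cong refl)
      fix a assume "a \<in> {size nu..n}"
      then have e: "t ^ (a * a) * real p ^ (?l * a) / (qpoch t (n - a) * qpoch t (a - size nu)) =
        column_coeff lam n a * qrecip t a (size nu)" by (simp add: column_coeff_def qrecip_def)
      show "fps_const (column_coeff lam n a) * (fps_X ^ a * (qtail t fps_X a n *
      (fps_const (Ccoeff lam' nu (real p) * qrecip t a (size nu)) * fps_X ^ sum_mset nu))) =
        C nu * (fps_const (t ^ (a * a) * real p ^ (?l * a) / (qpoch t (n - a) * qpoch t (a - size nu))) * fps_X ^ a * qtail t fps_X a n)"
        unfolding e C_def fps_const_mult[symmetric] by (simp only: ac_simps)
    qed
    finally show "C nu * (\<Sum>a=size nu..n.
      fps_const (t ^ (a * a) * real p ^ (?l * a) / (qpoch t (n - a) * qpoch t (a - size nu))) * fps_X ^ a * qtail t fps_X a n) =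
      (\<Sum>a\<le>n. fps_const (column_coeff lam n a) * (fps_X ^ a * (qtail t fps_X a n *
      (fps_const (Ccoeff lam' nu (real p) * qrecip t a (size nu)) * fps_X ^ sum_mset nu))))" by simp
  qed
  also have "\<dots> = (\<Sum>a\<le>n. \<Sum>nu\<in>subpartitions lam'. fps_const (column_coeff lam n a) * (fps_X ^ a * (qtail t fps_X a n *
      (fps_const (Ccoeff lam' nu (real p) * qrecip t a (size nu)) * fps_X ^ sum_mset nu))))"
    by (rule sum.swap)
  finally show ?thesis unfolding sub_series_def lam'_def[symmetric] sum_distrib_left .
qed

lemma moment_series_0: "moment_series lam 0 = 1"
proof (rule fps_ext)
  fix N
  have "fps_nth (moment_series lam 0) N = (\<Sum>mu\<in>partitions_of N. if mu = {#} then 1 else 0)"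
    unfolding moment_series_def fps_nth_Abs_fps
    by (intro sum.cong refl) (auto simp: qrecip_def cl_weight_empty[OF p])
  also have "\<dots> = (if {#} \<in> partitions_of N then 1 else 0)" by simp
  also have "\<dots> = fps_nth 1 N" by (auto simp: partitions_of_def int_partition_def)
  finally show "fps_nth (moment_series lam 0) N = fps_nth 1 N" .
qed

lemma sub_series_0: "sub_series lam 0 = 1"
proof -
  have "sub_series lam 0 = (\<Sum>nu\<in>subpartitions lam. if nu = {#} then 1 else 0)"
    unfolding sub_series_def
    by (intro sum.cong refl) (auto simp: qrecip_def Ccoeff_empty[OF t_bounds(5)])
  also have "\<dots> = (if {#} \<in> subpartitions lam then 1 else 0)" by (rule sum.delta) (rule finite_subpartitions)
  also have "\<dots> = 1" by (simp add: subpartitions_def int_partition_def part_le_def)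
  finally show ?thesis .
qed

lemma qtail_split: "a \<le> n \<Longrightarrow> qtail t z 0 n = qtail t z a n * qtail t z 0 a"
proof (induction n)
  case (Suc n)
  then show ?case by (cases "a = Suc n") (simp_all add: qtail_Suc le_Suc_eq ac_simps)
qed simp

text \<open>The difference \<open>D\<close> of the two sides satisfies a homogeneous recursion. Its
  term \<open>a = 0\<close> vanishes because \<open>D\<close> is 0 at \<open>n = 0\<close>, and a
  term with \<open>a > 0\<close> carries \<open>fps_X ^ a\<close>, so it uses only lower
  coefficients. The induction on the degree runs over all \<open>lam\<close> and \<open>n\<close> at
  once, as the recursion changes both.\<close>

lemma qtail_moment_series:
  assumes "int_partition lam"
  shows "qtail t fps_X 0 n * moment_series lam n = sub_series lam n"
proof -
  define D where "D lam n = qtail t fps_X 0 n * moment_series lam n - sub_series lam n" for lam n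
  have rec: "D lam n = (\<Sum>a\<le>n. fps_X ^ a * (fps_const (column_coeff lam n a) * qtail t fps_X a n * D (remove_column lam) a))"
    if "int_partition lam" for lam n
  proof -
    have "D lam n = (\<Sum>a\<le>n. qtail t fps_X 0 n * (fps_const (column_coeff lam n a) * (fps_X ^ a * moment_series (remove_column lam) a))
       - fps_const (column_coeff lam n a) * (fps_X ^ a * (qtail t fps_X a n * sub_series (remove_column lam) a)))"
      unfolding D_def moment_series_rec[OF that, of n] sub_series_rec[OF that, of n]
      by (simp only: sum_distrib_left sum_subtractf)
    also have "\<dots> = (\<Sum>a\<le>n. fps_X ^ a * (fps_const (column_coeff lam n a) * qtail t fps_X a n * D (remove_column lam) a))"
    proof (intro sum.cong refl)
      fix a assume "a \<in> {..n}"
      then have "qtail t fps_X 0 n = qtail t fps_X a n * qtail t fps_X 0 a" by (intro qtail_split) simp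
      then show "qtail t fps_X 0 n * (fps_const (column_coeff lam n a) * (fps_X ^ a * moment_series (remove_column lam) a))
       - fps_const (column_coeff lam n a) * (fps_X ^ a * (qtail t fps_X a n * sub_series (remove_column lam) a))
       = fps_X ^ a * (fps_const (column_coeff lam n a) * qtail t fps_X a n * D (remove_column lam) a)"
        unfolding D_def by (simp only: right_diff_distrib ac_simps)
    qed
    finally show ?thesis .
  qed
  have D0: "D lam 0 = 0" for lam by (simp add: D_def moment_series_0 sub_series_0)
  have "\<forall>lam n. int_partition lam \<longrightarrow> fps_nth (D lam n) N = 0" for N
  proof (induction N rule: less_induct)
    case (less N)
    show ?case
    proof (intro allI impI)
      fix lam n assume lam: "int_partition lam"
      have "fps_nth (fps_X ^ a * (fps_const (column_coeff lam n a) * qtail t fps_X a n * D (remove_column lam) a)) N = 0" for a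
      proof (cases "a = 0")
        case True
        then show ?thesis using D0 by simp
      next
        case False
        have "fps_nth (fps_const (column_coeff lam n a) * qtail t fps_X a n * D (remove_column lam) a) (N - a) = 0" if "a \<le> N"
          unfolding fps_mult_nth[of _ "D (remove_column lam) a"]
        proof (intro sum.neutral ballI)
          fix i assume "i \<in> {0..N - a}"
          then have "N - a - i < N" using False that by simp
          then show "fps_nth (fps_const (column_coeff lam n a) * qtail t fps_X a n) i * fps_nth (D (remove_column lam) a) (N - a - i) = 0"
            using less.IH int_partition_remove_column by simp
        qed
        then show ?thesis by (simp add: fps_X_power_mult_nth)
      qed
      then show "fps_nth (D lam n) N = 0" unfolding rec[OF lam, of n] fps_sum_nth by simp
    qed
  qed
  then have "D lam n = 0" using assms by (intro fps_ext) simp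
  then show ?thesis by (simp add: D_def)
qed

section \<open>Passage to the limit\<close>

definition cl_series :: "nat multiset \<Rightarrow> real fps" where
  "cl_series lam = Abs_fps (\<lambda>N. \<Sum>mu\<in>partitions_of N. cl_weight p lam mu)"

text \<open>The finite identity is multiplied by \<open>qpoch t n\<close>, which turns every
  \<open>qrecip\<close> into a \<open>qfall\<close> tending to 1. Each coefficient involves only
  finite sums, so the limit is taken term by term.\<close>

lemma qpoch_inf_cl_series:
  assumes lam: "int_partition lam"
  shows "qpoch_inf (fps_X * fps_const t) t * cl_series lam =
    (\<Sum>nu\<in>subpartitions lam. fps_const (Ccoeff lam nu (real p)) * fps_X ^ sum_mset nu)" (is "_ = ?S")
proof (rule fps_ext)
  fix N
  let ?P = "\<lambda>n. qtail t fps_X 0 n"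
  have P: "(\<lambda>n. fps_nth (?P n) k) \<longlonglongrightarrow> fps_nth (qpoch_inf (fps_X * fps_const t) t) k" for k
  proof -
    \<comment> \<open>The factor \<open>t\<close> in the argument raises the exponents from
      \<open>j\<close> to \<open>j + 1\<close>, which identifies \<open>?P n\<close> with a partial
      product of \<open>qpoch_inf\<close>.\<close>
    have "?P n = (\<Prod>j<n. 1 - (fps_X * fps_const t) * fps_const (t ^ j))" for n
      unfolding qtail_def prod.atLeast1_atMost_eq
      by (simp only: power_Suc fps_const_mult[symmetric] ac_simps)
    then show ?thesis using qpoch_inf_tendsto[of "fps_X * fps_const t" t k] t_bounds by simp
  qed
  have M: "(\<lambda>n. qpoch t n * fps_nth (moment_series lam n) k) \<longlonglongrightarrow> fps_nth (cl_series lam) k" for k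
  proof -
    have "qpoch t n * fps_nth (moment_series lam n) k = (\<Sum>mu\<in>partitions_of k. cl_weight p lam mu * qfall t n (size mu))" for n
      by (simp add: moment_series_def sum_distrib_left mult.left_commute flip: qpoch_mult_qrecip[OF t_bounds(1,3)])
    moreover have "(\<lambda>n. \<Sum>mu\<in>partitions_of k. cl_weight p lam mu * qfall t n (size mu)) \<longlonglongrightarrow>
      (\<Sum>mu\<in>partitions_of k. cl_weight p lam mu * 1)"
      by (intro tendsto_sum tendsto_mult tendsto_const qfall_tendsto t_bounds)
    ultimately show ?thesis by (simp add: cl_series_def)
  qed
  have eq: "qpoch t n * fps_nth (sub_series lam n) N = (\<Sum>nu\<in>subpartitions lam. Ccoeff lam nu (real p) * qfall t n (size nu) * fps_nth (fps_X ^ sum_mset nu) N)" for n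
    unfolding sub_series_def fps_sum_nth sum_distrib_left fps_mult_left_const_nth qpoch_mult_qrecip[OF t_bounds(1,3), symmetric]
    by (simp only: ac_simps)
  have "(\<lambda>n. qpoch t n * fps_nth (sub_series lam n) N) \<longlonglongrightarrow>
     (\<Sum>nu\<in>subpartitions lam. Ccoeff lam nu (real p) * 1 * fps_nth (fps_X ^ sum_mset nu) N)"
    unfolding eq by (intro tendsto_sum tendsto_mult tendsto_const qfall_tendsto t_bounds)
  then have S: "(\<lambda>n. qpoch t n * fps_nth (sub_series lam n) N) \<longlonglongrightarrow> fps_nth ?S N"
    by (simp only: mult_1_right fps_sum_nth fps_mult_left_const_nth)
  \<comment> \<open>The same sequence, rewritten by the finite identity as a Cauchy product, has a
    second limit; the two limits agree.\<close>
  have eq2: "qpoch t n * fps_nth (sub_series lam n) N = (\<Sum>i=0..N. fps_nth (?P n) i * (qpoch t n * fps_nth (moment_series lam n) (N - i)))" for n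
    unfolding qtail_moment_series[OF lam, symmetric] fps_mult_nth sum_distrib_left by (simp only: ac_simps)
  have "(\<lambda>n. qpoch t n * fps_nth (sub_series lam n) N) \<longlonglongrightarrow>
     (\<Sum>i=0..N. fps_nth (qpoch_inf (fps_X * fps_const t) t) i * fps_nth (cl_series lam) (N - i))"
    unfolding eq2 by (intro tendsto_sum tendsto_mult P M)
  from LIMSEQ_unique[OF this S]
  show "fps_nth (qpoch_inf (fps_X * fps_const t) t * cl_series lam) N = fps_nth ?S N" by (simp only: fps_mult_nth)
qed

text \<open>Convergence of formal power series means that each coefficient is eventually constant.
  The coefficient of degree \<open>N\<close> no longer changes once the finite index set contains
  \<open>partitions_of N\<close>.\<close>

lemma has_sum_cl_series:
  "((\<lambda>mu. fps_const (cl_weight p lam mu) * fps_X ^ sum_mset mu) has_sum cl_series lam) {mu. int_partition mu}"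
  unfolding has_sum_def
proof (rule tendsto_fpsI)
  fix N
  let ?f = "\<lambda>mu. fps_const (cl_weight p lam mu) * (fps_X :: real fps) ^ sum_mset mu"
  have "eventually (\<lambda>F. F \<subseteq> {mu. int_partition mu} \<and> partitions_of N \<subseteq> F)
     (finite_subsets_at_top {mu. int_partition mu})"
    unfolding eventually_finite_subsets_at_top
    by (rule exI[of _ "partitions_of N"]) (simp, auto simp: partitions_of_def)
  moreover have "eventually finite (finite_subsets_at_top {mu::nat multiset. int_partition mu})"
    by (rule eventually_finite_subsets_at_top_weakI)
  ultimately show "eventually (\<lambda>F. fps_nth (\<Sum>mu\<in>F. ?f mu) N = fps_nth (cl_series lam) N)
     (finite_subsets_at_top {mu. int_partition mu})"
  proof eventually_elim
    case (elim F)
    have "fps_nth (\<Sum>mu\<in>F. ?f mu) N = (\<Sum>mu\<in>F. if sum_mset mu = N then cl_weight p lam mu else 0)"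
      unfolding fps_sum_nth by (intro sum.cong refl) simp
    also have "\<dots> = (\<Sum>mu\<in>partitions_of N. if sum_mset mu = N then cl_weight p lam mu else 0)"
      using elim by (intro sum.mono_neutral_right) (auto simp: partitions_of_def)
    also have "\<dots> = fps_nth (cl_series lam) N"
      unfolding cl_series_def fps_nth_Abs_fps by (intro sum.cong refl) (simp add: partitions_of_def)
    finally show ?case .
  qed
qed

end

theorem theorem10:
  fixes p :: nat and lam :: "nat multiset"
  assumes "prime p" and "int_partition lam"
  shows "((\<lambda>mu. fps_const (real (torsion_monomial p lam (pgroup p mu)) /
                            real (card (auto (pgroup p mu)))) * fps_X ^ sum_mset mu)
          has_sum
          (1 / qpoch_inf (fps_X * fps_const (1 / real p)) (1 / real p) *
           (\<Sum>nu | int_partition nu \<and> part_le nu lam.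
              fps_const (Ccoeff lam nu (real p)) * fps_X ^ sum_mset nu)))
         {mu. int_partition mu}"
proof -
  define t where "t = 1 / real p"
  note t = t_bounds[OF assms(1) t_def]
  let ?Q = "qpoch_inf (fps_X * fps_const t) t"
  \<comment> \<open>Every partial product has constant term 1, hence so does \<open>?Q\<close>; it
    is therefore a unit, and the division in the statement is multiplication by its inverse.\<close>
  have "(\<lambda>n. fps_nth (\<Prod>j<n. 1 - (fps_X * fps_const t) * fps_const (t ^ j)) 0) \<longlonglongrightarrow> fps_nth ?Q 0"
    using t by (intro qpoch_inf_tendsto) auto
  moreover have "fps_nth (\<Prod>j<n. 1 - (fps_X * fps_const t) * fps_const (t ^ j)) 0 = 1" for n
    by (induction n) simp_all
  ultimately have "fps_nth ?Q 0 = 1" by (simp add: LIMSEQ_const_iff)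
  then have "1 / ?Q * (?Q * cl_series p lam) = cl_series p lam"
    by (simp add: fps_divide_unit inverse_mult_eq_1 flip: mult.assoc)
  then show ?thesis
    using has_sum_cl_series[OF assms(1) t_def, of lam]
    unfolding qpoch_inf_cl_series[OF assms(1) t_def assms(2)]
    by (simp add: subpartitions_def t_def cl_weight_def)
qed

end
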